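(* Let $V_{3,\epsilon}$ (for small $\epsilon\ge0$) be the potential of the twice Darboux-transformed operator of the $\phi^8$ model, as defined in the context, and write $V_{3,\epsilon}=2+\epsilon\widetilde V_3+O(\epsilon^2)$, i.e. $\widetilde V_3(x)=\partial_\epsilon V_{3,\epsilon}(x)\big|_{\epsilon=0}$. Then $$\widetilde V_3(x)=\frac65\,\mathrm{sech}^2\Big(\frac{x}{\sqrt2}\Big)+\frac35\,\mathrm{sech}^4\Big(\frac{x}{\sqrt2}\Big).$$ In particular, $x\widetilde V_3'(x)<0$ for all $x\ne0$.
   Context: For $\epsilon\in[0,1)$ let $W_\epsilon(u)=\frac14(1+\epsilon)^2(u^2-1)^2(\epsilon u^2-1)^2$, and let $H_\epsilon$ be the odd increasing solution of $H_\epsilon''=W_\epsilon'(H_\epsilon)$ with $H_\epsilon(x)\to\pm1$ as $x\to\pm\infty$ (so $H_0(x)=\tanh(x/\sqrt2)$). Let $L_{1,\epsilon}=-\partial_x^2+W_\epsilon''(H_\epsilon)$; it has ground state $H_\epsilon'$ with eigenvalue $0$. For $\epsilon=0$ the operator $L_{1,0}$ has exactly the two eigenvalues $0$ and $\frac32$, and for small $\epsilon$ the operator $L_{1,\epsilon}$ has a unique eigenvalue $\lambda_\epsilon$ near $\frac32$, with eigenfunction $\psi_\epsilon$. Darboux transformations: let $A_{1,\epsilon}f=(H_\epsilon')^{-1}\partial_x(H_\epsilon'f)$, so that $L_{1,\epsilon}=A_{1,\epsilon}A_{1,\epsilon}^*$, and $L_{2,\epsilon}=A_{1,\epsilon}^*A_{1,\epsilon}=-\partial_x^2+V_{2,\epsilon}$.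 Then $\varphi_\epsilon=A_{1,\epsilon}^*\psi_\epsilon$ is a (nowhere vanishing) ground state of $L_{2,\epsilon}$ with eigenvalue $\lambda_\epsilon$. Let $A_{2,\epsilon}f=\varphi_\epsilon^{-1}\partial_x(\varphi_\epsilon f)$, so that $L_{2,\epsilon}=A_{2,\epsilon}A_{2,\epsilon}^*+\lambda_\epsilon$, and define $L_{3,\epsilon}=A_{2,\epsilon}^*A_{2,\epsilon}+\lambda_\epsilon=-\partial_x^2+V_{3,\epsilon}$. Explicitly, $V_{2,\epsilon}=-W_\epsilon''(H_\epsilon)+\frac{(W_\epsilon'(H_\epsilon))^2}{W_\epsilon(H_\epsilon)}$ and $V_{3,\epsilon}=V_{2,\epsilon}-2\big(\varphi_\epsilon'/\varphi_\epsilon\big)'$; for $\epsilon=0$ one has $V_{3,0}\equiv2$. *)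

theory Defs
  imports "HOL-Analysis.Analysis" "HOL-Library.Landau_Symbols"
begin

definition W :: "real \<Rightarrow> real \<Rightarrow> real" where
  "W \<epsilon> u = 1/4 * (1 + \<epsilon>)\<^sup>2 * (u\<^sup>2 - 1)\<^sup>2 * (\<epsilon> * u\<^sup>2 - 1)\<^sup>2"

definition twice_differentiable :: "(real \<Rightarrow> real) \<Rightarrow> bool" where
  "twice_differentiable f \<longleftrightarrow>
     (\<forall>x. f differentiable at x) \<and> (\<forall>x. deriv f differentiable at x)"

definition kink :: "real \<Rightarrow> (real \<Rightarrow> real) \<Rightarrow> bool" where
  "kink \<epsilon> H \<longleftrightarrow>
     (\<forall>x. H (- x) = - H x) \<and> strict_mono H \<and>
     twice_differentiable H \<and>
     (\<forall>x. deriv (deriv H) x = deriv (W \<epsilon>) (H x)) \<and>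
     (H \<longlongrightarrow> 1) at_top \<and> (H \<longlongrightarrow> - 1) at_bot"

definition schroedinger :: "(real \<Rightarrow> real) \<Rightarrow> (real \<Rightarrow> real) \<Rightarrow> real \<Rightarrow> real" where
  "schroedinger V f x = - deriv (deriv f) x + V x * f x"

(* The potentials considered here are bounded and continuous, so the L2 eigenfunctions of
   the self-adjoint operator are, up to null sets, the classical square-integrable solutions
   of the eigenvalue equation; H2-membership is then automatic. *)
definition eigenpair :: "(real \<Rightarrow> real) \<Rightarrow> real \<Rightarrow> (real \<Rightarrow> real) \<Rightarrow> bool" where
  "eigenpair V \<mu> \<psi> \<longleftrightarrow>
     twice_differentiable \<psi> \<and> integrable lborel (\<lambda>x. (\<psi> x)\<^sup>2) \<and> (\<exists>x. \<psi> x \<noteq> 0) \<and>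
     (\<forall>x. schroedinger V \<psi> x = \<mu> * \<psi> x)"

definition V\<^sub>1 :: "real \<Rightarrow> (real \<Rightarrow> real) \<Rightarrow> real \<Rightarrow> real" where
  "V\<^sub>1 \<epsilon> H x = deriv (deriv (W \<epsilon>)) (H x)"

(* Formal L2-adjoint of the first-order operator A f = (1/h) (h f)'. *)
definition darboux_adj :: "(real \<Rightarrow> real) \<Rightarrow> (real \<Rightarrow> real) \<Rightarrow> real \<Rightarrow> real" where
  "darboux_adj h g x = - h x * deriv (\<lambda>y. g y / h y) x"

(* With A f = (1/H') (H' f)', the operator A* A equals -d^2/dx^2 + V2; the formula uses
   H'' = W'(H) and the first integral (H')^2 = 2 W(H). *)
definition V\<^sub>2 :: "real \<Rightarrow> (real \<Rightarrow> real) \<Rightarrow> real \<Rightarrow> real" where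
  "V\<^sub>2 \<epsilon> H x = - deriv (deriv (W \<epsilon>)) (H x) + (deriv (W \<epsilon>) (H x))\<^sup>2 / W \<epsilon> (H x)"

(* For an eigenpair (\<mu>, \<psi>) of -d^2/dx^2 + V1, the function \<phi> = A* \<psi> satisfies
   -\<phi>'' + V2 \<phi> = \<mu> \<phi>. With B f = (1/\<phi>) (\<phi> f)', one has -d^2/dx^2 + V2 = B B* + \<mu>
   and B* B + \<mu> = -d^2/dx^2 + V3. *)
definition V\<^sub>3 :: "real \<Rightarrow> (real \<Rightarrow> real) \<Rightarrow> (real \<Rightarrow> real) \<Rightarrow> real \<Rightarrow> real" where
  "V\<^sub>3 \<epsilon> H \<psi> x =
     (let \<phi> = darboux_adj (deriv H) \<psi>
      in V\<^sub>2 \<epsilon> H x - 2 * deriv (\<lambda>y. deriv \<phi> y / \<phi> y) x)"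

definition sech :: "real \<Rightarrow> real" where
  "sech x = 1 / cosh x"

end

theory Submission
  imports Defs
begin

text \<open>The argument compares the ground state \<open>\<phi>\<close> of the once transformed operator with an explicit
approximate one. Write \<open>W = P\<^sup>2 / 4\<close> with \<open>P = (1 + \<epsilon>) (1 - u\<^sup>2) (1 - \<epsilon> u\<^sup>2)\<close>. The first integral of
the kink equation is \<open>H' = P(H) / sqrt 2\<close>, so every potential is a polynomial in \<open>u = H\<close>, and
\<open>q = \<phi>' / \<phi>\<close> solves the Riccati equation \<open>q' + q\<^sup>2 = V\<^sub>2 - \<mu>\<close>, where \<open>\<mu>\<close> is the eigenvalue. Eliminating
\<open>q'\<close> gives \<open>V\<^sub>3 = 2 q\<^sup>2 + 2 \<mu> - V\<^sub>2\<close>, so it suffices to know \<open>q\<close> and \<open>\<mu>\<close> up to \<open>O(\<epsilon>\<^sup>2)\<close>.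

In the variable \<open>u\<close>, perturbation theory of the Riccati equation has a polynomial solution:
\<open>q = (- u + \<epsilon> (11 u + u\<^sup>3) / 5) / sqrt 2\<close> and \<open>\<mu> = 3/2 + 12/5 \<epsilon>\<close> solve it with an error
\<open>\<epsilon>\<^sup>2\<close> times a polynomial (\<open>slope_riccati\<close>). Inserted into the formula for \<open>V\<^sub>3\<close>, they give
\<open>2 + \<epsilon> (9/5 - 12/5 u\<^sup>2 + 3/5 u\<^sup>4) + O(\<epsilon>\<^sup>2)\<close>. The order-zero term does not depend on \<open>u\<close>, so
\<open>H = tanh (x / sqrt 2) + O(\<epsilon>)\<close> (\<open>dist_kink_tanh\<close>) is all that is needed about the kink.

It remains to see that the true \<open>q\<close> and \<open>\<mu>\<close> are this close to the approximate ones \<open>Q\<close> and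
\<open>\<nu>\<close>. The function \<open>h = \<phi>' - Q \<phi>\<close> is, up to sign, the second Darboux transform of \<open>\<phi>\<close> with
respect to the approximate ground state. It solves \<open>h'' = c h + O(\<epsilon>\<^sup>2) \<phi>\<close> with \<open>c\<close> close to
\<open>2 - \<mu>\<close>, because the twice transformed potential is close to \<open>2\<close>. As \<open>\<mu>\<close> is near \<open>3/2\<close>, \<open>c\<close> is
bounded below by a positive constant, and the maximum principle gives
\<open>|h| \<le> 400 \<epsilon>\<^sup>2 max |\<phi>|\<close> (\<open>abs_h_le\<close>). This uses that \<open>\<phi>\<close> and \<open>\<phi>'\<close> vanish at
infinity, which follows from the square-integrability of \<open>\<psi>\<close> (\<open>L2_solution_decays\<close>). The bound on \<open>h\<close>
forces \<open>|\<phi>|\<close> to peak near the origin (\<open>peak\<close>) and to be comparable with its maximum on compact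
sets (\<open>\<phi>_lower_bound\<close>). Hence \<open>q - Q = h / \<phi>\<close> is \<open>O(\<epsilon>\<^sup>2)\<close> there, and the differential equation
for \<open>h\<close> on \<open>[0, 1]\<close> yields \<open>\<mu> - \<nu> = O(\<epsilon>\<^sup>2)\<close>.
Since all constants are uniform in \<open>\<epsilon>\<close>, these bounds at each single \<open>\<epsilon>\<close> give the expansion.\<close>

section \<open>Real analysis on the line\<close>

lemma attains_positive_max:
  fixes f :: "real \<Rightarrow> real"
  assumes cont: "continuous_on UNIV f"
    and top: "(f \<longlongrightarrow> 0) at_top" and bot: "(f \<longlongrightarrow> 0) at_bot"
    and pos: "f a > 0"
  obtains x0 where "\<And>x. f x \<le> f x0"
proof -
  obtain r where r: "\<And>x. x \<ge> r \<Longrightarrow> f x < f a"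
    using order_tendstoD(2)[OF top pos] by (auto simp: eventually_at_top_linorder)
  obtain l where l: "\<And>x. x \<le> l \<Longrightarrow> f x < f a"
    using order_tendstoD(2)[OF bot pos] by (auto simp: eventually_at_bot_linorder)
  have a: "a \<in> {l..r}"
    using r[of a] l[of a] by force
  obtain x0 where x0: "x0 \<in> {l..r}" "\<forall>x\<in>{l..r}. f x \<le> f x0"
    using continuous_attains_sup[of "{l..r}" f] a continuous_on_subset[OF cont] by blast
  have fa: "f a \<le> f x0"
    using a x0(2) by blast
  have "f x \<le> f x0" for x
  proof (cases "x \<in> {l..r}")
    case False
    then have "f x < f a"
      using l[of x] r[of x] by (cases "x \<le> l") auto
    then show ?thesis using fa by linarith
  qed (use x0(2) in blast)
  with that show thesis by blast
qed

text \<open>At a maximum above \<open>B\<close> the second derivative would be positive. This is applied to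
\<open>f'' = c f + g\<close> with \<open>c\<close> bounded below by a positive constant and \<open>g\<close> small.\<close>

lemma max_principle:
  fixes f f' f'' :: "real \<Rightarrow> real"
  assumes f': "\<And>x. (f has_real_derivative f' x) (at x)"
    and f'': "\<And>x. (f' has_real_derivative f'' x) (at x)"
    and top: "(f \<longlongrightarrow> 0) at_top" and bot: "(f \<longlongrightarrow> 0) at_bot"
    and B: "B \<ge> 0" and convex: "\<And>x. f x > B \<Longrightarrow> f'' x > 0"
  shows "f x \<le> B"
proof (rule ccontr)
  assume "\<not> f x \<le> B"
  then have x: "f x > B" by simp
  have cont: "continuous_on UNIV f"
    using f' by (meson DERIV_isCont continuous_at_imp_continuous_on)
  obtain m where m: "\<And>y. f y \<le> f m"
    using attains_positive_max[OF cont top bot, of x] x B by auto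
  have "f' m = 0"
    using DERIV_local_max[OF f'[of m], of 1] m by simp
  moreover have "f'' m > 0"
    using convex[of m] m[of x] x by simp
  ultimately obtain d where d: "d > 0" "\<And>t. 0 < t \<Longrightarrow> t < d \<Longrightarrow> f' (m + t) > 0"
    using DERIV_pos_inc_right[OF f''[of m]] by auto
  have "f m < f (m + d / 2)"
  proof (rule DERIV_pos_imp_increasing_open[of m "m + d / 2" f])
    show "m < m + d / 2" using d(1) by simp
    show "\<exists>y. (f has_real_derivative y) (at z) \<and> 0 < y" if "m < z" "z < m + d / 2" for z
      using f'[of z] d(2)[of "z - m"] that d(1) by auto
    show "continuous_on {m..m + d / 2} f"
      using cont continuous_on_subset by blast
  qed
  with m[of "m + d / 2"] show False by simp
qed

text \<open>By the mean value theorem \<open>f'\<close> is small somewhere in each far interval of length one, and it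
varies by at most the supremum of \<open>|f''|\<close> over that interval.\<close>

lemma deriv_tendsto_0:
  fixes f f' f'' :: "real \<Rightarrow> real"
  assumes f': "\<And>x. (f has_real_derivative f' x) (at x)"
    and f'': "\<And>x. (f' has_real_derivative f'' x) (at x)"
    and lim: "(f \<longlongrightarrow> l) at_top" and lim'': "(f'' \<longlongrightarrow> 0) at_top"
  shows "(f' \<longlongrightarrow> 0) at_top"
proof (rule tendstoI)
  fix e :: real assume e: "e > 0"
  have "\<forall>\<^sub>F x in at_top. \<bar>f x - l\<bar> < e / 3 \<and> \<bar>f'' x\<bar> < e / 3"
    using tendstoD[OF lim, of "e / 3"] tendstoD[OF lim'', of "e / 3"] e
    by (auto simp: dist_real_def elim: eventually_elim2)
  then obtain a where a: "\<And>x. x \<ge> a \<Longrightarrow> \<bar>f x - l\<bar> < e / 3 \<and> \<bar>f'' x\<bar> < e / 3"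
    by (auto simp: eventually_at_top_linorder)
  have "\<bar>f' x\<bar> < e" if x: "x \<ge> a" for x
  proof -
    obtain z where z: "x < z" "z < x + 1" "f (x + 1) - f x = f' z"
      using MVT2[of x "x + 1" f f'] f' by auto
    obtain w where w: "x < w" "w < z" "f' z - f' x = (z - x) * f'' w"
      using MVT2[of x z f' f''] f'' z by auto
    have "\<bar>f' z - f' x\<bar> \<le> 1 * \<bar>f'' w\<bar>"
      unfolding w(3) abs_mult using z by (intro mult_right_mono) auto
    moreover have "\<bar>f'' w\<bar> < e / 3"
      using a[of w] w x by auto
    moreover have "\<bar>f (x + 1) - l\<bar> < e / 3" "\<bar>f x - l\<bar> < e / 3"
      using a[of "x + 1"] a[of x] x by auto
    ultimately show ?thesis using z(3) by linarith
  qed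
  then show "\<forall>\<^sub>F x in at_top. dist (f' x) 0 < e"
    by (auto simp: eventually_at_top_linorder dist_real_def)
qed

lemma integrable_not_bounded_below:
  fixes F :: "real \<Rightarrow> real"
  assumes int: "integrable lborel F" and nonneg: "\<And>x. F x \<ge> 0"
    and c: "c > 0" and low: "\<And>x. x \<ge> b \<Longrightarrow> F x \<ge> c"
  shows False
proof -
  obtain n :: nat where n: "integral\<^sup>L lborel F < real n * c"
    using reals_Archimedean3[OF c] by blast
  have "integral\<^sup>L lborel (\<lambda>x. c * indicator {b..b + real n} x) \<le> integral\<^sup>L lborel F"
  proof (rule integral_mono[OF _ int])
    show "integrable lborel (\<lambda>x. c * indicator {b..b + real n} x)"
      by (intro integrable_mult_right integrable_real_indicator) auto
  qed (auto simp: indicator_def nonneg low)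
  moreover have "integral\<^sup>L lborel (\<lambda>x. c * indicator {b..b + real n} x) = c * real n"
    by simp
  ultimately show False using n by (simp add: mult.commute)
qed

text \<open>Where \<open>c > 0\<close>, the square of a solution of \<open>f'' = c f\<close> is convex. A nonnegative convex integrable
function on a half-line cannot increase anywhere, so it decreases to \<open>0\<close>.\<close>

lemma L2_solution_decays:
  fixes f f' c :: "real \<Rightarrow> real"
  assumes f': "\<And>x. (f has_real_derivative f' x) (at x)"
    and f'': "\<And>x. (f' has_real_derivative c x * f x) (at x)"
    and L2: "integrable lborel (\<lambda>x. (f x)\<^sup>2)"
    and lim: "(c \<longlongrightarrow> k) at_top" and k: "k > 0"
  shows "(f \<longlongrightarrow> 0) at_top" and "(f' \<longlongrightarrow> 0) at_top"
proof -
  obtain a where a: "\<And>x. x \<ge> a \<Longrightarrow> c x > 0"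
    using order_tendstoD(1)[OF lim k] by (auto simp: eventually_at_top_linorder)
  define F F' where "F = (\<lambda>x. (f x)\<^sup>2)" and "F' = (\<lambda>x. 2 * f x * f' x)"
  have dF: "(F has_real_derivative F' x) (at x)" for x
    unfolding F_def F'_def by (auto intro!: derivative_eq_intros f')
  have dF': "(F' has_real_derivative 2 * (f' x)\<^sup>2 + 2 * (c x * (f x)\<^sup>2)) (at x)" for x
    unfolding F'_def
    by (auto intro!: derivative_eq_intros f' f'' simp: power2_eq_square algebra_simps)
  have mono: "F' x \<le> F' y" if "a \<le> x" "x \<le> y" for x y
  proof (rule DERIV_nonneg_imp_nondecreasing[OF that(2)])
    fix z assume z: "x \<le> z" "z \<le> y"
    then have "c z > 0" using a that by auto
    then show "\<exists>d. (F' has_real_derivative d) (at z) \<and> d \<ge> 0"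
      by (intro exI[of _ "2 * (f' z)\<^sup>2 + 2 * (c z * (f z)\<^sup>2)"] conjI dF') auto
  qed
  have "F' b \<le> 0" if b: "b \<ge> a" for b
  proof (rule ccontr)
    assume "\<not> F' b \<le> 0"
    then have pos: "F' b > 0" by simp
    have "F x \<ge> F' b" if x: "x \<ge> b + 1" for x
    proof -
      obtain z where z: "b < z" "z < x" "F x - F b = (x - b) * F' z"
        using MVT2[of b x F F'] dF x by auto
      have "1 * F' b \<le> (x - b) * F' z"
        using z x pos mono[of b z] b by (intro mult_mono) auto
      moreover have "F b \<ge> 0" by (simp add: F_def)
      ultimately show ?thesis using z(3) by linarith
    qed
    then show False
      using integrable_not_bounded_below[of F "F' b" "b + 1"] pos L2 by (auto simp: F_def)
  qed
  then have anti: "F y \<le> F x" if "a \<le> x" "x \<le> y" for x y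
    using DERIV_nonpos_imp_nonincreasing[OF that(2), of F] dF that by (meson order_trans)
  have "(F \<longlongrightarrow> 0) at_top"
  proof (rule tendstoI)
    fix e :: real assume e: "e > 0"
    have "\<exists>x\<ge>a. F x < e"
      using integrable_not_bounded_below[of F e a] L2 e by (force simp: F_def)
    then obtain x where x: "x \<ge> a" "F x < e" by blast
    then have "\<bar>F y\<bar> < e" if "y \<ge> x" for y
      using anti[of x y] that by (simp add: F_def)
    then show "\<forall>\<^sub>F x in at_top. dist (F x) 0 < e"
      by (auto simp: eventually_at_top_linorder dist_real_def)
  qed
  then have "((\<lambda>x. sqrt (F x)) \<longlongrightarrow> 0) at_top"
    using tendsto_real_sqrt by fastforce
  then show lim0: "(f \<longlongrightarrow> 0) at_top"
    by (simp add: F_def tendsto_rabs_zero_iff)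
  have "((\<lambda>x. c x * f x) \<longlongrightarrow> 0) at_top"
    using tendsto_mult[OF lim lim0] by simp
  then show "(f' \<longlongrightarrow> 0) at_top"
    by (rule deriv_tendsto_0[OF f' f'' lim0])
qed

lemma L2_solution_decays_at_bot:
  fixes f f' c :: "real \<Rightarrow> real"
  assumes f': "\<And>x. (f has_real_derivative f' x) (at x)"
    and f'': "\<And>x. (f' has_real_derivative c x * f x) (at x)"
    and L2: "integrable lborel (\<lambda>x. (f x)\<^sup>2)"
    and lim: "(c \<longlongrightarrow> k) at_bot" and k: "k > 0"
  shows "(f \<longlongrightarrow> 0) at_bot" and "(f' \<longlongrightarrow> 0) at_bot"
proof -
  have neg: "(uminus has_real_derivative - 1) (at x)" for x :: real
    by (auto intro!: derivative_eq_intros)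
  have d: "((\<lambda>x. f (- x)) has_real_derivative - f' (- x)) (at x)" for x
    using DERIV_chain2[OF f' neg] by simp
  have d2: "((\<lambda>x. - f' (- x)) has_real_derivative c (- x) * f (- x)) (at x)" for x
    using DERIV_minus[OF DERIV_chain2[OF f'' neg]] by simp
  have L: "integrable lborel (\<lambda>x. (f (- x))\<^sup>2)"
    using lborel_integrable_real_affine[OF L2, of "-1" 0] by simp
  have l: "((\<lambda>x. c (- x)) \<longlongrightarrow> k) at_top"
    using lim by (simp add: filterlim_at_bot_mirror)
  show "(f \<longlongrightarrow> 0) at_bot"
    using L2_solution_decays(1)[OF d d2 L l k] by (simp add: filterlim_at_bot_mirror)
  show "(f' \<longlongrightarrow> 0) at_bot"
    using tendsto_minus[OF L2_solution_decays(2)[OF d d2 L l k]]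
    by (simp add: filterlim_at_bot_mirror)
qed

lemma tanh_artanh_real:
  fixes x :: real
  assumes "\<bar>x\<bar> < 1"
  shows "tanh (artanh x) = x"
proof -
  define t where "t = (1 + x) / (1 - x)"
  have t: "t > 0" using assms by (auto simp: t_def abs_less_iff)
  have "tanh (artanh x) = tanh (ln (sqrt t))"
    using t by (simp add: artanh_def t_def[symmetric] ln_sqrt)
  also have "\<dots> = (t - 1) / (t + 1)"
    using t by (simp add: tanh_ln_real)
  also have "\<dots> = x"
    using assms by (auto simp: t_def field_simps abs_less_iff)
  finally show ?thesis .
qed

text \<open>The bound at \<open>y = 0\<close> also identifies the value \<open>f 0 = a\<close>, which the one-sided derivative refers to.\<close>

lemma quadratic_remainder:
  fixes f :: "real \<Rightarrow> real"
  assumes e: "e > 0" and bound: "\<And>y. 0 \<le> y \<Longrightarrow> y < e \<Longrightarrow> \<bar>f y - (a + y * D)\<bar> \<le> C * y\<^sup>2"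
  shows "(f has_real_derivative D) (at 0 within {0..})"
    and "(\<lambda>y. f y - (a + y * D)) \<in> O[at_right 0](\<lambda>y. y\<^sup>2)"
proof -
  have f0: "f 0 = a" using bound[of 0] e by simp
  have "((\<lambda>y. (f y - f 0) / (y - 0) - D) \<longlongrightarrow> 0) (at 0 within {0..})"
  proof (rule Lim_null_comparison)
    show "\<forall>\<^sub>F y in at 0 within {0..}. norm ((f y - f 0) / (y - 0) - D) \<le> C * y"
      unfolding eventually_at
    proof (intro exI[of _ e] conjI ballI impI e)
      fix y :: real assume "y \<in> {0..}" "y \<noteq> 0 \<and> dist y 0 < e"
      then have y: "y > 0" "y < e" by auto
      have "(f y - f 0) / (y - 0) - D = (f y - (a + y * D)) / y"
        using y by (simp add: f0 field_simps)
      then show "norm ((f y - f 0) / (y - 0) - D) \<le> C * y"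
        using bound[of y] y by (simp add: divide_le_eq power2_eq_square mult_ac)
    qed
    have "((\<lambda>y. C * y) \<longlongrightarrow> C * 0) (at 0 within {0..})" by (intro tendsto_intros)
    then show "((\<lambda>y. C * y) \<longlongrightarrow> 0) (at 0 within {0..})" by simp
  qed
  then show "(f has_real_derivative D) (at 0 within {0..})"
    unfolding has_field_derivative_iff using Lim_null by blast
  have "\<forall>\<^sub>F y in at_right 0. norm (f y - (a + y * D)) \<le> C * norm (y\<^sup>2)"
    using eventually_at_right_less[of 0] eventually_at_right_real[OF e]
    by eventually_elim (use bound in auto)
  then show "(\<lambda>y. f y - (a + y * D)) \<in> O[at_right 0](\<lambda>y. y\<^sup>2)"
    by (rule bigoI)
qed

section \<open>The potential as the square of a polynomial speed\<close>

text \<open>The kink obeys the first-order equation \<open>H' = P(H) / sqrt 2\<close>, where \<open>P\<close> is this polynomial.\<close>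

definition speed :: "real \<Rightarrow> real \<Rightarrow> real" where
  "speed \<epsilon> u = (1 + \<epsilon>) * (1 - u\<^sup>2) * (1 - \<epsilon> * u\<^sup>2)"

definition speed' :: "real \<Rightarrow> real \<Rightarrow> real" where
  "speed' \<epsilon> u = (1 + \<epsilon>) * (4 * \<epsilon> * u ^ 3 - 2 * (1 + \<epsilon>) * u)"

definition speed'' :: "real \<Rightarrow> real \<Rightarrow> real" where
  "speed'' \<epsilon> u = (1 + \<epsilon>) * (12 * \<epsilon> * u\<^sup>2 - 2 * (1 + \<epsilon>))"

definition inv_sqrt2 :: real where "inv_sqrt2 = 1 / sqrt 2"

lemma inv_sqrt2_pos: "inv_sqrt2 > 0" by (simp add: inv_sqrt2_def)

lemma inv_sqrt2_square: "inv_sqrt2 * inv_sqrt2 = 1/2" by (simp add: inv_sqrt2_def)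

lemma inv_sqrt2_bounds: "7/10 < inv_sqrt2" "inv_sqrt2 < 3/4"
proof -
  have "(7/10)\<^sup>2 < inv_sqrt2\<^sup>2" "inv_sqrt2\<^sup>2 < (3/4)\<^sup>2"
    using inv_sqrt2_square by (simp_all add: power2_eq_square)
  then show "7/10 < inv_sqrt2" "inv_sqrt2 < 3/4"
    using inv_sqrt2_pos power2_less_imp_less[of "7/10" inv_sqrt2] power2_less_imp_less[of inv_sqrt2 "3/4"] by auto
qed

lemma W_speed: "W \<epsilon> u = (speed \<epsilon> u)\<^sup>2 / 4"
  unfolding W_def speed_def by (simp add: power_mult_distrib power2_commute)

lemma DERIV_speed: "(speed \<epsilon> has_real_derivative speed' \<epsilon> u) (at u)"
  unfolding speed_def[abs_def] speed'_def
  by (auto intro!: derivative_eq_intros) algebra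

lemma DERIV_speed': "(speed' \<epsilon> has_real_derivative speed'' \<epsilon> u) (at u)"
  unfolding speed'_def[abs_def] speed''_def
  by (auto intro!: derivative_eq_intros simp: power2_eq_square)

lemma DERIV_W: "(W \<epsilon> has_real_derivative speed \<epsilon> u * speed' \<epsilon> u / 2) (at u)"
  unfolding W_speed[abs_def] by (auto intro!: derivative_eq_intros DERIV_speed)

lemma deriv_W: "deriv (W \<epsilon>) = (\<lambda>u. speed \<epsilon> u * speed' \<epsilon> u / 2)"
  using DERIV_W DERIV_imp_deriv by blast

lemma deriv_deriv_W:
  "deriv (deriv (W \<epsilon>)) u = ((speed' \<epsilon> u)\<^sup>2 + speed \<epsilon> u * speed'' \<epsilon> u) / 2"
  unfolding deriv_W
  by (rule DERIV_imp_deriv)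
     (auto intro!: derivative_eq_intros DERIV_speed DERIV_speed' simp: power2_eq_square)

section \<open>The approximate Riccati solution\<close>

text \<open>\<open>V\<^sub>2\<close> as a function of the height \<open>u = H x\<close>. Since \<open>W = P\<^sup>2 / 4\<close>, the quotient in the definition of
\<open>V\<^sub>2\<close> is the polynomial \<open>P'\<^sup>2\<close>.\<close>

definition second_potential :: "real \<Rightarrow> real \<Rightarrow> real" where
  "second_potential \<epsilon> u = ((speed' \<epsilon> u)\<^sup>2 - speed \<epsilon> u * speed'' \<epsilon> u) / 2"

text \<open>\<open>sqrt 2\<close> times the approximate logarithmic derivative of \<open>\<phi>\<close>, as a function of \<open>u = H x\<close>. For
\<open>\<epsilon> = 0\<close> the function \<open>\<phi>\<close> is proportional to \<open>sech (x / sqrt 2)\<close>, which gives \<open>- u\<close>. If \<open>k\<close> is the coefficient of \<open>\<epsilon>\<close> and \<open>\<nu>\<^sub>1\<close> that of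
the eigenvalue, the linearized Riccati equation for odd \<open>k\<close> integrates to
\<open>(1 - u\<^sup>2) k = (7 - 2 \<nu>\<^sub>1) u - 2 u\<^sup>3 - u\<^sup>5 / 5\<close>. Regularity at \<open>u = 1\<close> forces \<open>\<nu>\<^sub>1 = 12/5\<close>, and then
\<open>k = (11 u + u\<^sup>3) / 5\<close>.\<close>

definition slope :: "real \<Rightarrow> real \<Rightarrow> real" where
  "slope \<epsilon> u = \<epsilon> * (11 * u + u ^ 3) / 5 - u"

definition slope' :: "real \<Rightarrow> real \<Rightarrow> real" where
  "slope' \<epsilon> u = \<epsilon> * (11 + 3 * u\<^sup>2) / 5 - 1"

definition resid :: "real \<Rightarrow> real \<Rightarrow> real" where
  "resid \<epsilon> u =
     19/10 - 351/50 * u ^ 2 - 86/25 * u ^ 4 + 42/25 * u ^ 6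
     + \<epsilon> * (1 - 9/10 * u ^ 2 - 19/5 * u ^ 4 + 37/10 * u ^ 6)
     + \<epsilon> ^ 2 * (u ^ 2 - u ^ 4 + 2 * u ^ 6)"

definition resid' :: "real \<Rightarrow> real \<Rightarrow> real" where
  "resid' \<epsilon> u =
     - 351/25 * u - 344/25 * u ^ 3 + 252/25 * u ^ 5
     + \<epsilon> * (- 9/5 * u - 76/5 * u ^ 3 + 111/5 * u ^ 5)
     + \<epsilon> ^ 2 * (2 * u - 4 * u ^ 3 + 12 * u ^ 5)"

lemma DERIV_slope: "(slope \<epsilon> has_real_derivative slope' \<epsilon> u) (at u)"
  unfolding slope_def[abs_def] slope'_def
  by (auto intro!: derivative_eq_intros)

lemma DERIV_resid: "(resid \<epsilon> has_real_derivative resid' \<epsilon> u) (at u)"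
  unfolding resid_def[abs_def] resid'_def
  by (auto intro!: derivative_eq_intros)

text \<open>The Riccati equation \<open>q' + q\<^sup>2 = V\<^sub>2 - \<nu>\<close> for \<open>q = slope(H) / sqrt 2\<close>, with its exact error term: since
\<open>H' = P(H) / sqrt 2\<close>, the derivative \<open>q'\<close> is \<open>P slope' / 2\<close>.\<close>

lemma slope_riccati:
  "second_potential \<epsilon> u - (3/2 + 12/5 * \<epsilon>) - speed \<epsilon> u * slope' \<epsilon> u / 2 - (slope \<epsilon> u)\<^sup>2 / 2
     = \<epsilon>\<^sup>2 * resid \<epsilon> u"
  unfolding second_potential_def speed_def speed'_def speed''_def slope_def slope'_def resid_def
  by (simp add: field_simps eval_nat_numeral)

lemma abs_monomial_le_1:
  fixes e u :: real
  assumes "\<bar>e\<bar> \<le> 1" "\<bar>u\<bar> \<le> 1"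
  shows "\<bar>e ^ i * u ^ j\<bar> \<le> 1"
  using assms by (simp add: abs_mult power_abs power_le_one mult_le_one)

lemma abs_resid_le:
  assumes "\<bar>\<epsilon>\<bar> \<le> 1" "\<bar>u\<bar> \<le> 1"
  shows "\<bar>resid \<epsilon> u\<bar> \<le> 30" "\<bar>resid' \<epsilon> u\<bar> \<le> 100"
proof -
  note m = abs_monomial_le_1[OF assms]
  note ms = m[of 0 1] m[of 0 2] m[of 0 3] m[of 0 4] m[of 0 5] m[of 0 6]
    m[of 1 0] m[of 1 1] m[of 1 2] m[of 1 3] m[of 1 4] m[of 1 5] m[of 1 6]
    m[of 2 1] m[of 2 2] m[of 2 3] m[of 2 4] m[of 2 5] m[of 2 6]
  show "\<bar>resid \<epsilon> u\<bar> \<le> 30" "\<bar>resid' \<epsilon> u\<bar> \<le> 100"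
    using ms unfolding resid_def resid'_def power_0 power_one_right mult_1_left mult_1_right
      abs_le_iff ring_distribs by linarith+
qed

text \<open>The expression on the right is the twice transformed potential \<open>V\<^sub>2 - 2 q'\<close> built from the approximate
\<open>q\<close>. It is constantly \<open>2\<close> for \<open>\<epsilon> = 0\<close>, and the bound keeps it above the eigenvalue near \<open>3/2\<close>.\<close>

lemma perturbed_gap:
  assumes "0 \<le> \<epsilon>" "\<epsilon> \<le> 1" "\<bar>u\<bar> \<le> 1"
  shows "2 - 27 * \<epsilon> \<le> second_potential \<epsilon> u - speed \<epsilon> u * slope' \<epsilon> u"
proof -
  define c where "c = 9/5 - 12/5 * u ^ 2 + 3/5 * u ^ 4
    + \<epsilon> * (4/5 - 16/5 * u ^ 2 - 3 * u ^ 4 + 7/5 * u ^ 6)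
    + \<epsilon> ^ 2 * (1 + 1/5 * u ^ 2 - 23/5 * u ^ 4 + 17/5 * u ^ 6)
    + \<epsilon> ^ 3 * (u ^ 2 - u ^ 4 + 2 * u ^ 6)"
  have e1: "\<bar>\<epsilon>\<bar> \<le> 1" using assms by simp
  note m = abs_monomial_le_1[OF e1 assms(3)]
  have "\<bar>c\<bar> \<le> 27"
    using m[of 0 2] m[of 0 4] m[of 1 0] m[of 1 2] m[of 1 4] m[of 1 6]
      m[of 2 0] m[of 2 2] m[of 2 4] m[of 2 6] m[of 3 2] m[of 3 4] m[of 3 6]
    unfolding c_def power_0 power_one_right mult_1_left mult_1_right
      abs_le_iff ring_distribs by linarith
  then have "\<epsilon> * (- 27) \<le> \<epsilon> * c"
    using assms by (intro mult_left_mono) auto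
  moreover have "second_potential \<epsilon> u - speed \<epsilon> u * slope' \<epsilon> u = 2 + \<epsilon> * c"
    unfolding c_def second_potential_def speed_def speed'_def speed''_def slope'_def
    by (simp add: field_simps eval_nat_numeral)
  ultimately show ?thesis by linarith
qed

section \<open>The first variation\<close>

text \<open>\<open>\<partial>V\<^sub>3 / \<partial>\<epsilon>\<close> at \<open>\<epsilon> = 0\<close>, as a function of the height \<open>u = tanh (x / sqrt 2)\<close> of the unperturbed kink.\<close>

definition first_variation :: "real \<Rightarrow> real" where
  "first_variation u = 9/5 - 12/5 * u\<^sup>2 + 3/5 * u ^ 4"

text \<open>The left-hand expression is \<open>2 q\<^sup>2 + 2 \<nu> - V\<^sub>2\<close> at the approximate solution \<open>q = slope / sqrt 2\<close>; with the
exact logarithmic derivative and eigenvalue in their place it is \<open>V\<^sub>3\<close>.\<close>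

lemma approximate_V\<^sub>3_expansion:
  assumes "0 \<le> \<epsilon>" "\<epsilon> \<le> 1" "\<bar>u\<bar> \<le> 1"
  shows "\<bar>(slope \<epsilon> u)\<^sup>2 + 2 * (3/2 + 12/5 * \<epsilon>) - second_potential \<epsilon> u - (2 + \<epsilon> * first_variation u)\<bar> \<le> 34 * \<epsilon>\<^sup>2"
proof -
  define c where "c = - 3 + 271/25 * u ^ 2 + 97/25 * u ^ 4 - 49/25 * u ^ 6
    + \<epsilon> * (- 1 + 2 * u ^ 2 + 3 * u ^ 4 - 4 * u ^ 6)
    + \<epsilon> ^ 2 * (u ^ 4 - u ^ 2 - 2 * u ^ 6)"
  have e1: "\<bar>\<epsilon>\<bar> \<le> 1" using assms by simp
  note m = abs_monomial_le_1[OF e1 assms(3)]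
  have "\<bar>c\<bar> \<le> 34"
    using m[of 0 2] m[of 0 4] m[of 0 6] m[of 1 0] m[of 1 2] m[of 1 4] m[of 1 6]
      m[of 2 2] m[of 2 4] m[of 2 6]
    unfolding c_def power_0 power_one_right mult_1_left mult_1_right
      abs_le_iff ring_distribs by linarith
  then have "\<bar>\<epsilon>\<^sup>2 * c\<bar> \<le> \<epsilon>\<^sup>2 * 34"
    unfolding abs_mult by (intro mult_mono) auto
  moreover have "(slope \<epsilon> u)\<^sup>2 + 2 * (3/2 + 12/5 * \<epsilon>) - second_potential \<epsilon> u - (2 + \<epsilon> * first_variation u) = \<epsilon>\<^sup>2 * c"
    unfolding c_def second_potential_def speed_def speed'_def speed''_def slope_def first_variation_def
    by (simp add: field_simps eval_nat_numeral)
  ultimately show ?thesis by linarith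
qed

lemma first_variation_lipschitz:
  assumes "\<bar>a\<bar> \<le> 1" "\<bar>b\<bar> \<le> 1"
  shows "\<bar>first_variation a - first_variation b\<bar> \<le> 8 * \<bar>a - b\<bar>"
proof -
  have sq: "a\<^sup>2 \<le> 1" "b\<^sup>2 \<le> 1" using assms by (simp_all add: abs_square_le_1)
  have "\<bar>12/5 - 3/5 * w\<bar> \<le> 4" if "0 \<le> w" "w \<le> 2" for w :: real
    using that by (simp add: abs_le_iff)
  from this[of "a\<^sup>2 + b\<^sup>2"] have "\<bar>12/5 - 3/5 * (a\<^sup>2 + b\<^sup>2)\<bar> \<le> 4"
    using sq by simp
  then have "\<bar>a + b\<bar> * \<bar>12/5 - 3/5 * (a\<^sup>2 + b\<^sup>2)\<bar> \<le> 2 * 4"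
    using assms by (intro mult_mono) auto
  then have "\<bar>a - b\<bar> * (\<bar>a + b\<bar> * \<bar>12/5 - 3/5 * (a\<^sup>2 + b\<^sup>2)\<bar>) \<le> \<bar>a - b\<bar> * 8"
    by (intro mult_left_mono) auto
  moreover have "\<bar>first_variation a - first_variation b\<bar>
      = \<bar>- (a - b) * ((a + b) * (12/5 - 3/5 * (a\<^sup>2 + b\<^sup>2)))\<bar>"
    by (rule arg_cong[of _ _ abs]) (simp add: first_variation_def field_simps eval_nat_numeral)
  ultimately show ?thesis by (simp only: abs_mult abs_minus_cancel)
qed

lemma first_variation_tanh:
  "first_variation (tanh y) = 6/5 * (sech y)\<^sup>2 + 3/5 * (sech y) ^ 4"
proof -
  have "1 - (tanh y)\<^sup>2 = ((cosh y)\<^sup>2 - (sinh y)\<^sup>2) / (cosh y)\<^sup>2"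
    using cosh_real_pos[of y] by (simp add: tanh_def power_divide diff_divide_distrib)
  then have "(sech y)\<^sup>2 = 1 - (tanh y)\<^sup>2"
    by (simp add: hyperbolic_pythagoras sech_def power_divide)
  then have "6/5 * (sech y)\<^sup>2 + 3/5 * (sech y) ^ 4
      = 6/5 * (1 - (tanh y)\<^sup>2) + 3/5 * (1 - (tanh y)\<^sup>2)\<^sup>2"
    by (metis power_even_eq numeral_Bit0 mult_2)
  then show ?thesis
    unfolding first_variation_def by (simp add: field_simps eval_nat_numeral)
qed

lemma DERIV_first_variation_tanh:
  "((\<lambda>x. first_variation (tanh (inv_sqrt2 * x))) has_real_derivative
     - (12/5 * inv_sqrt2 * tanh (inv_sqrt2 * x) * (2 - (tanh (inv_sqrt2 * x))\<^sup>2) * (1 - (tanh (inv_sqrt2 * x))\<^sup>2))) (at x)"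
  unfolding first_variation_def
  by (auto intro!: derivative_eq_intros simp: field_simps eval_nat_numeral)

lemma first_variation_decreases_away_from_0:
  assumes "x \<noteq> 0"
  shows "x * deriv (\<lambda>x. first_variation (tanh (inv_sqrt2 * x))) x < 0"
proof -
  have t: "(tanh (inv_sqrt2 * x))\<^sup>2 < 1"
    using tanh_real_lt_1[of "inv_sqrt2 * x"] tanh_real_gt_neg1[of "inv_sqrt2 * x"]
    by (simp add: abs_square_less_1 abs_less_iff)
  have "x * tanh (inv_sqrt2 * x) > 0"
    using assms inv_sqrt2_pos by (cases "x > 0") (auto simp: zero_less_mult_iff mult_pos_neg mult_less_0_iff)
  then have "(12/5 * inv_sqrt2) * (x * tanh (inv_sqrt2 * x)) * ((2 - (tanh (inv_sqrt2 * x))\<^sup>2) * (1 - (tanh (inv_sqrt2 * x))\<^sup>2)) > 0"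
    using t inv_sqrt2_pos by (intro mult_pos_pos[OF mult_pos_pos mult_pos_pos]) simp_all
  moreover have "x * deriv (\<lambda>x. first_variation (tanh (inv_sqrt2 * x))) x
      = - ((12/5 * inv_sqrt2) * (x * tanh (inv_sqrt2 * x)) * ((2 - (tanh (inv_sqrt2 * x))\<^sup>2) * (1 - (tanh (inv_sqrt2 * x))\<^sup>2)))"
    unfolding DERIV_imp_deriv[OF DERIV_first_variation_tanh] by simp
  ultimately show ?thesis by linarith
qed

section \<open>The kink\<close>

lemma twice_differentiableD:
  assumes "twice_differentiable f"
  shows "(f has_real_derivative deriv f x) (at x)"
    and "(deriv f has_real_derivative deriv (deriv f) x) (at x)"
  using assms by (simp_all add: twice_differentiable_def DERIV_deriv_iff_real_differentiable)

text \<open>The bound \<open>1/400\<close> matches the constant \<open>400\<close> in the maximum-principle estimate: it turns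
\<open>400 \<epsilon>\<^sup>2\<close> into a quantity at most \<open>\<epsilon>\<close>.\<close>

locale perturbed_kink =
  fixes \<epsilon> :: real and H :: "real \<Rightarrow> real"
  assumes eps_nonneg: "0 \<le> \<epsilon>" and eps_small: "\<epsilon> \<le> 1/400"
    and kink: "kink \<epsilon> H"
begin

lemma abs_H_less_1: "\<bar>H x\<bar> < 1"
proof -
  have mono: "strict_mono H" and top: "(H \<longlongrightarrow> 1) at_top" and bot: "(H \<longlongrightarrow> - 1) at_bot"
    using kink by (auto simp: kink_def)
  have "H (x + 1) \<le> 1"
    by (rule tendsto_lowerbound[OF top])
       (auto simp: eventually_at_top_linorder strict_mono_less_eq[OF mono])
  moreover have "- 1 \<le> H (x - 1)"
    by (rule tendsto_upperbound[OF bot])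
       (auto simp: eventually_at_bot_linorder strict_mono_less_eq[OF mono])
  moreover have "H (x - 1) < H x" "H x < H (x + 1)"
    using mono by (auto simp: strict_mono_def)
  ultimately show ?thesis by linarith
qed

lemma abs_H_le_1: "\<bar>H x\<bar> \<le> 1"
  using abs_H_less_1[of x] by simp

lemma speed_H_pos: "speed \<epsilon> (H x) > 0"
proof -
  have 1: "(H x)\<^sup>2 < 1"
    using abs_H_less_1[of x] by (simp add: abs_square_less_1)
  have "\<epsilon> * (H x)\<^sup>2 \<le> \<epsilon> * 1"
    using 1 eps_nonneg by (intro mult_left_mono) auto
  then show ?thesis
    using 1 eps_nonneg eps_small unfolding speed_def by (intro mult_pos_pos) auto
qed

text \<open>The energy \<open>H'\<^sup>2 - 2 W(H)\<close> is conserved, and it vanishes because \<open>H\<close> and \<open>H''\<close> converge at infinity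
to \<open>1\<close> and \<open>0\<close>, which forces \<open>H' \<longlongrightarrow> 0\<close>. Monotonicity selects the positive root.\<close>

lemma DERIV_H: "(H has_real_derivative inv_sqrt2 * speed \<epsilon> (H x)) (at x)"
proof -
  have td: "twice_differentiable H" and eq: "\<And>x. deriv (deriv H) x = deriv (W \<epsilon>) (H x)"
    and top: "(H \<longlongrightarrow> 1) at_top" and mono: "strict_mono H"
    using kink by (auto simp: kink_def)
  note d1 = twice_differentiableD(1)[OF td]
  have d2: "(deriv H has_real_derivative speed \<epsilon> (H x) * speed' \<epsilon> (H x) / 2) (at x)" for x
    using twice_differentiableD(2)[OF td, of x] unfolding eq deriv_W .
  define E where "E = (\<lambda>x. (deriv H x)\<^sup>2 - (speed \<epsilon> (H x))\<^sup>2 / 2)"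
  have dE: "(E has_real_derivative 0) (at x)" for x
    unfolding E_def
    by (auto intro!: derivative_eq_intros d1 d2 DERIV_chain2[OF DERIV_speed])
  have speed_tendsto: "((\<lambda>x. speed \<epsilon> (H x)) \<longlongrightarrow> 0) at_top"
    unfolding speed_def using top by (auto intro!: tendsto_eq_intros)
  moreover have "((\<lambda>x. speed' \<epsilon> (H x)) \<longlongrightarrow> speed' \<epsilon> 1) at_top"
    unfolding speed'_def using top by (auto intro!: tendsto_eq_intros)
  ultimately have "((\<lambda>x. speed \<epsilon> (H x) * speed' \<epsilon> (H x) / 2) \<longlongrightarrow> 0) at_top"
    by (auto intro!: tendsto_eq_intros)
  then have "(deriv H \<longlongrightarrow> 0) at_top"
    by (rule deriv_tendsto_0[OF d1 d2 top])
  with speed_tendsto have "(E \<longlongrightarrow> 0) at_top"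
    unfolding E_def by (auto intro!: tendsto_eq_intros)
  moreover have "E y = E x" for y
    using DERIV_isconst_all dE by blast
  ultimately have "E x = 0"
    by (metis (no_types, lifting) LIM_unique tendsto_const tendsto_unique trivial_limit_at_top_linorder ext)
  then have "(deriv H x)\<^sup>2 = (inv_sqrt2 * speed \<epsilon> (H x))\<^sup>2"
    by (simp add: E_def inv_sqrt2_def power_mult_distrib power_divide)
  moreover have "deriv H x \<ge> 0"
    using mono_on_imp_deriv_nonneg[of UNIV H] d1[of x] mono
    by (simp add: strict_mono_mono mono_imp_mono_on)
  ultimately have "deriv H x = inv_sqrt2 * speed \<epsilon> (H x)"
    using speed_H_pos[of x] inv_sqrt2_pos by (simp add: power2_eq_iff_nonneg)
  with d1[of x] show ?thesis by simp
qed

lemma deriv_H: "deriv H = (\<lambda>x. inv_sqrt2 * speed \<epsilon> (H x))"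
  using DERIV_H DERIV_imp_deriv by blast

lemma DERIV_comp_H:
  "(f has_real_derivative f') (at (H x)) \<Longrightarrow>
   ((\<lambda>x. f (H x)) has_real_derivative f' * (inv_sqrt2 * speed \<epsilon> (H x))) (at x)"
  by (rule DERIV_chain2[OF _ DERIV_H])

lemma H_0: "H 0 = 0"
proof -
  have "H (- 0) = - H 0" using kink unfolding kink_def by blast
  then show ?thesis by simp
qed

text \<open>In the coordinate \<open>artanh H\<close> the kink equation reads
\<open>y' = (1 + \<epsilon>) (1 - \<epsilon> H\<^sup>2) / sqrt 2\<close>, whose right-hand side is within \<open>\<epsilon>\<close> of the constant \<open>1 / sqrt 2\<close>;
and \<open>tanh\<close> is a contraction.\<close>

lemma dist_kink_tanh: "\<bar>H x - tanh (inv_sqrt2 * x)\<bar> \<le> \<epsilon> * \<bar>x\<bar>"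
proof -
  define y where "y = (\<lambda>x. artanh (H x) - inv_sqrt2 * x)"
  define y' where "y' = (\<lambda>x. inv_sqrt2 * ((1 + \<epsilon>) * (1 - \<epsilon> * (H x)\<^sup>2) - 1))"
  have dy: "(y has_real_derivative y' x) (at x)" for x
  proof -
    have "1 - (H x)\<^sup>2 \<noteq> 0"
      using abs_H_less_1[of x] by (simp add: abs_square_eq_1)
    then have "1 / (1 - (H x)\<^sup>2) * (inv_sqrt2 * speed \<epsilon> (H x)) - inv_sqrt2 = y' x"
      by (simp add: y'_def speed_def field_simps)
    then show ?thesis
      unfolding y_def using abs_H_less_1[of x]
      by (auto intro!: derivative_eq_intros
          DERIV_chain2[OF artanh_real_has_field_derivative DERIV_H])
  qed
  have y'_le: "\<bar>y' x\<bar> \<le> \<epsilon>" for x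
  proof -
    define v where "v = (H x)\<^sup>2"
    have v: "0 \<le> v" "v \<le> 1"
      using abs_H_less_1[of x] by (auto simp: v_def abs_square_le_1)
    have "(1 + \<epsilon>) * (1 - \<epsilon> * v) - 1 = \<epsilon> * (1 - v - \<epsilon> * v)"
      by algebra
    moreover have "\<bar>1 - v - \<epsilon> * v\<bar> \<le> 1"
    proof -
      have "0 \<le> \<epsilon> * v"
        using v eps_nonneg by simp
      moreover have "\<epsilon> * v \<le> 1 * 1"
        using v eps_small by (intro mult_mono) auto
      ultimately show ?thesis using v by linarith
    qed
    ultimately have "\<bar>(1 + \<epsilon>) * (1 - \<epsilon> * v) - 1\<bar> \<le> \<epsilon> * 1"
      using eps_nonneg mult_left_mono[of "\<bar>1 - v - \<epsilon> * v\<bar>" 1 \<epsilon>] by (simp add: abs_mult)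
    then show ?thesis
      unfolding y'_def v_def[symmetric] abs_mult using inv_sqrt2_bounds inv_sqrt2_pos eps_nonneg
        mult_mono[of inv_sqrt2 1 "\<bar>(1 + \<epsilon>) * (1 - \<epsilon> * v) - 1\<bar>" \<epsilon>] by auto
  qed
  have lipschitz_y: "\<bar>y x - y 0\<bar> \<le> \<epsilon> * \<bar>x - 0\<bar>"
    using field_differentiable_bound[of UNIV y y' \<epsilon> 0 x] dy y'_le
    by simp
  have lipschitz_tanh: "\<bar>tanh a - tanh b\<bar> \<le> 1 * \<bar>a - b\<bar>" for a b :: real
  proof -
    have "\<bar>1 - (tanh z)\<^sup>2\<bar> \<le> 1" for z :: real
      using tanh_real_lt_1[of z] tanh_real_gt_neg1[of z]
      by (simp add: abs_le_iff abs_square_le_1)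
    moreover have "(tanh has_real_derivative 1 - (tanh z)\<^sup>2) (at z)" for z :: real
      using has_field_derivative_tanh[of "\<lambda>z. z" z 1 UNIV] by simp
    ultimately show ?thesis
      using field_differentiable_bound[of UNIV tanh "\<lambda>z. 1 - (tanh z)\<^sup>2" 1 b a] by simp
  qed
  have "tanh (artanh (H x)) = H x"
    by (rule tanh_artanh_real[OF abs_H_less_1])
  then have "\<bar>H x - tanh (inv_sqrt2 * x)\<bar> \<le> \<bar>y x\<bar>"
    using lipschitz_tanh[of "artanh (H x)" "inv_sqrt2 * x"] by (simp add: y_def)
  also have "\<dots> \<le> \<epsilon> * \<bar>x\<bar>"
    using lipschitz_y by (simp add: y_def H_0)
  finally show ?thesis .
qed

lemma H_deriv_bounds: "0 < inv_sqrt2 * speed \<epsilon> (H x)" "inv_sqrt2 * speed \<epsilon> (H x) \<le> 1"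
proof -
  show "0 < inv_sqrt2 * speed \<epsilon> (H x)" using speed_H_pos inv_sqrt2_pos by simp
  define v where "v = (H x)\<^sup>2"
  have v: "0 \<le> v" "v \<le> 1"
    using abs_H_le_1[of x] by (auto simp: v_def abs_square_le_1)
  have ev: "0 \<le> \<epsilon> * v" "\<epsilon> * v \<le> 1 * 1"
    using v eps_nonneg eps_small by (simp, intro mult_mono, auto)
  have "speed \<epsilon> (H x) \<le> (1 + \<epsilon>) * 1 * 1"
    unfolding speed_def v_def[symmetric] using v ev eps_nonneg by (intro mult_mono) auto
  then have "inv_sqrt2 * speed \<epsilon> (H x) \<le> 3/4 * (401/400)"
    using inv_sqrt2_bounds inv_sqrt2_pos eps_small speed_H_pos[of x] by (intro mult_mono) auto
  then show "inv_sqrt2 * speed \<epsilon> (H x) \<le> 1" by simp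
qed

lemma H_strict_mono: "x < y \<Longrightarrow> H x < H y"
  using kink by (simp add: kink_def strict_mono_def)

text \<open>As long as \<open>H\<close> stays below \<open>1/4\<close>, it grows with speed more than \<open>1/4\<close>.\<close>

lemma H_1_ge: "H 1 \<ge> 1/4"
proof (rule ccontr)
  assume less: "\<not> H 1 \<ge> 1/4"
  obtain z where z: "0 < z" "z < 1" "H 1 - H 0 = (1 - 0) * (inv_sqrt2 * speed \<epsilon> (H z))"
    using MVT2[of 0 1 H "\<lambda>x. inv_sqrt2 * speed \<epsilon> (H x)"] DERIV_H by auto
  define v where "v = (H z)\<^sup>2"
  have "0 < H z" "H z < 1/4"
    using H_strict_mono[OF z(1)] H_strict_mono[OF z(2)] less by (auto simp: H_0)
  then have "(H z)\<^sup>2 \<le> (1/4)\<^sup>2"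
    by (intro power_mono) auto
  then have v: "0 \<le> v" "v \<le> 1/16"
    by (auto simp: v_def power2_eq_square)
  have "\<epsilon> * v \<le> 1 * (1/16)"
    using v eps_nonneg eps_small by (intro mult_mono) auto
  then have "1 * (15/16) * (15/16) \<le> speed \<epsilon> (H z)"
    unfolding speed_def v_def[symmetric] using v eps_nonneg by (intro mult_mono) auto
  then have "7/10 * (1 * (15/16) * (15/16)) \<le> inv_sqrt2 * speed \<epsilon> (H z)"
    using inv_sqrt2_bounds by (intro mult_mono) auto
  with z(3) less show False by (simp add: H_0)
qed

lemma abs_less_1_if_abs_H_small:
  assumes "\<bar>H x\<bar> < 1/4"
  shows "\<bar>x\<bar> < 1"
proof (rule ccontr)
  assume "\<not> \<bar>x\<bar> < 1"
  then consider "x \<ge> 1" | "x \<le> - 1" by linarith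
  then show False
  proof cases
    case 1
    then show False using H_strict_mono[of 1 x] H_1_ge assms by (cases "x = 1") auto
  next
    case 2
    have "H (- x) = - H x" using kink unfolding kink_def by blast
    then show False using 2 H_strict_mono[of 1 "- x"] H_1_ge assms by (cases "x = - 1") auto
  qed
qed

end

section \<open>The ground state of the transformed operator\<close>

text \<open>The radius \<open>1/8\<close> keeps \<open>\<mu>\<close> away from the eigenvalue \<open>0\<close>, and far enough below the unperturbed value \<open>2\<close> of
\<open>V\<^sub>3\<close> to leave room for the perturbation.\<close>

locale perturbed_eigenpair = perturbed_kink +
  fixes \<mu> :: real and \<psi> :: "real \<Rightarrow> real"
  assumes eigenpair: "eigenpair (V\<^sub>1 \<epsilon> H) \<mu> \<psi>" and near: "\<bar>\<mu> - 3/2\<bar> < 1/8"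
begin

text \<open>The logarithmic derivative \<open>H'' / H'\<close> of the first ground state.\<close>

definition G where "G x = inv_sqrt2 * speed' \<epsilon> (H x)"

definition \<phi> where "\<phi> = darboux_adj (deriv H) \<psi>"

text \<open>The derivative of \<open>\<phi>\<close>. In terms of \<open>\<psi>\<close> and \<open>\<phi>\<close> the eigenvalue equation is the first-order system
\<open>\<psi>' = G \<psi> - \<phi>\<close>, \<open>\<phi>' = \<mu> \<psi> - G \<phi>\<close>.\<close>

definition \<phi>' where "\<phi>' x = \<mu> * \<psi> x - G x * \<phi> x"

definition U where "U x = second_potential \<epsilon> (H x)"

lemma DERIV_\<psi>: "(\<psi> has_real_derivative deriv \<psi> x) (at x)"
  using eigenpair twice_differentiableD(1) unfolding eigenpair_def by blast

lemma DERIV_deriv_\<psi>: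
  "(deriv \<psi> has_real_derivative
     (((speed' \<epsilon> (H x))\<^sup>2 + speed \<epsilon> (H x) * speed'' \<epsilon> (H x)) / 2 - \<mu>) * \<psi> x) (at x)"
proof -
  have "schroedinger (V\<^sub>1 \<epsilon> H) \<psi> x = \<mu> * \<psi> x" and td: "twice_differentiable \<psi>"
    using eigenpair unfolding eigenpair_def by blast+
  then have "deriv (deriv \<psi>) x =
      (((speed' \<epsilon> (H x))\<^sup>2 + speed \<epsilon> (H x) * speed'' \<epsilon> (H x)) / 2 - \<mu>) * \<psi> x"
    by (simp add: schroedinger_def V\<^sub>1_def deriv_deriv_W algebra_simps)
  with twice_differentiableD(2)[OF td, of x] show ?thesis by simp
qed

lemma DERIV_G: "(G has_real_derivative speed \<epsilon> (H x) * speed'' \<epsilon> (H x) / 2) (at x)"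
proof -
  have "inv_sqrt2 * (speed'' \<epsilon> (H x) * (inv_sqrt2 * speed \<epsilon> (H x))) = (inv_sqrt2 * inv_sqrt2) * (speed \<epsilon> (H x) * speed'' \<epsilon> (H x))"
    by simp
  also have "\<dots> = speed \<epsilon> (H x) * speed'' \<epsilon> (H x) / 2"
    unfolding inv_sqrt2_square by simp
  finally show ?thesis
    unfolding G_def[abs_def]
    using DERIV_cmult[OF DERIV_comp_H[OF DERIV_speed'], of inv_sqrt2 \<epsilon> x] by (simp only:)
qed

lemma G_square: "(G x)\<^sup>2 = (speed' \<epsilon> (H x))\<^sup>2 / 2"
  using inv_sqrt2_square by (simp add: G_def power2_eq_square)

lemma \<phi>_eq: "\<phi> x = G x * \<psi> x - deriv \<psi> x"
proof -
  define h where "h = (\<lambda>x. inv_sqrt2 * speed \<epsilon> (H x))"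
  have h: "h x \<noteq> 0"
    using speed_H_pos[of x] inv_sqrt2_pos by (simp add: h_def)
  have "(h has_real_derivative G x * h x) (at x)"
    unfolding h_def G_def
    using DERIV_cmult[OF DERIV_comp_H[OF DERIV_speed], of inv_sqrt2 \<epsilon> x] by (simp add: mult_ac)
  then have "((\<lambda>y. \<psi> y / h y) has_real_derivative
      (deriv \<psi> x * h x - \<psi> x * (G x * h x)) / (h x * h x)) (at x)"
    by (intro DERIV_divide DERIV_\<psi> h)
  then have "deriv (\<lambda>y. \<psi> y / h y) x = (deriv \<psi> x * h x - \<psi> x * (G x * h x)) / (h x * h x)"
    by (rule DERIV_imp_deriv)
  moreover have "- h x * ((deriv \<psi> x * h x - \<psi> x * (G x * h x)) / (h x * h x))
      = G x * \<psi> x - deriv \<psi> x"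
    using h by (simp add: divide_simps) algebra
  ultimately show ?thesis
    unfolding \<phi>_def darboux_adj_def deriv_H h_def[symmetric] by simp
qed

lemma DERIV_\<phi>: "(\<phi> has_real_derivative \<phi>' x) (at x)"
proof -
  have sq: "(speed' \<epsilon> (H x))\<^sup>2 = 2 * (G x)\<^sup>2"
    by (simp add: G_square)
  have "speed \<epsilon> (H x) * speed'' \<epsilon> (H x) / 2 * \<psi> x + deriv \<psi> x * G x
      - (((speed' \<epsilon> (H x))\<^sup>2 + speed \<epsilon> (H x) * speed'' \<epsilon> (H x)) / 2 - \<mu>) * \<psi> x = \<phi>' x"
    unfolding \<phi>'_def \<phi>_eq sq by (simp add: field_simps power2_eq_square)
  then show ?thesis
    unfolding \<phi>_eq[abs_def]
    using DERIV_diff[OF DERIV_mult[OF DERIV_G DERIV_\<psi>] DERIV_deriv_\<psi>, of x] by (simp only:)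
qed

lemma DERIV_\<phi>': "(\<phi>' has_real_derivative (U x - \<mu>) * \<phi> x) (at x)"
proof -
  have "\<mu> * deriv \<psi> x - (speed \<epsilon> (H x) * speed'' \<epsilon> (H x) / 2 * \<phi> x + \<phi>' x * G x)
      = ((G x)\<^sup>2 - speed \<epsilon> (H x) * speed'' \<epsilon> (H x) / 2 - \<mu>) * \<phi> x"
    unfolding \<phi>'_def \<phi>_eq by algebra
  also have "\<dots> = (U x - \<mu>) * \<phi> x"
    by (simp add: G_square U_def second_potential_def diff_divide_distrib)
  finally show ?thesis
    unfolding \<phi>'_def[abs_def]
    using DERIV_diff[OF DERIV_cmult[OF DERIV_\<psi>, of \<mu>] DERIV_mult[OF DERIV_G DERIV_\<phi>], of x]
    by (simp only: \<phi>'_def)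
qed

lemma tendsto_potential:
  assumes "(H \<longlongrightarrow> a) F" "\<bar>a\<bar> = 1"
  shows "((\<lambda>x. ((speed' \<epsilon> (H x))\<^sup>2 + speed \<epsilon> (H x) * speed'' \<epsilon> (H x)) / 2 - \<mu>) \<longlongrightarrow>
           2 * (1 - \<epsilon>\<^sup>2)\<^sup>2 - \<mu>) F"
proof -
  have a: "a\<^sup>2 = 1" "a ^ 3 = a" "a * a = 1"
    using assms(2) by (auto simp: abs_square_eq_1 power2_eq_square power3_eq_cube abs_if split: if_splits)
  have "((speed' \<epsilon> a)\<^sup>2 + speed \<epsilon> a * speed'' \<epsilon> a) / 2 = ((1 + \<epsilon>) * (4 * \<epsilon> - 2 * (1 + \<epsilon>)))\<^sup>2 * (a * a) / 2"
    by (simp add: speed_def speed'_def a(1,2)) algebra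
  also have "\<dots> = 2 * (1 - \<epsilon>\<^sup>2)\<^sup>2"
    unfolding a(3) by algebra
  finally have "((speed' \<epsilon> a)\<^sup>2 + speed \<epsilon> a * speed'' \<epsilon> a) / 2 = 2 * (1 - \<epsilon>\<^sup>2)\<^sup>2" .
  moreover have "((\<lambda>x. ((speed' \<epsilon> (H x))\<^sup>2 + speed \<epsilon> (H x) * speed'' \<epsilon> (H x)) / 2 - \<mu>) \<longlongrightarrow>
      ((speed' \<epsilon> a)\<^sup>2 + speed \<epsilon> a * speed'' \<epsilon> a) / 2 - \<mu>) F"
    unfolding speed_def speed'_def speed''_def
    by (intro tendsto_intros assms(1)) auto
  ultimately show ?thesis by simp
qed

lemma asymptotic_potential_pos: "2 * (1 - \<epsilon>\<^sup>2)\<^sup>2 - \<mu> > 0"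
proof -
  have "\<epsilon>\<^sup>2 \<le> (1/400)\<^sup>2"
    using eps_nonneg eps_small by (intro power_mono) auto
  then have "\<epsilon>\<^sup>2 \<le> 1/100" by (simp add: power2_eq_square)
  then have "(99/100)\<^sup>2 \<le> (1 - \<epsilon>\<^sup>2)\<^sup>2"
    by (intro power_mono) auto
  moreover have "(99/100)\<^sup>2 > (13/16 :: real)" by (simp add: power2_eq_square)
  ultimately show ?thesis using near by linarith
qed

text \<open>At both ends the potential \<open>V\<^sub>1\<close> tends to a value near \<open>2\<close>, which exceeds the eigenvalue near \<open>3/2\<close>.\<close>

lemma \<psi>_decays:
  shows "(\<psi> \<longlongrightarrow> 0) at_top" "(deriv \<psi> \<longlongrightarrow> 0) at_top" "(\<psi> \<longlongrightarrow> 0) at_bot" "(deriv \<psi> \<longlongrightarrow> 0) at_bot"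
proof -
  have L2: "integrable lborel (\<lambda>x. (\<psi> x)\<^sup>2)" and top: "(H \<longlongrightarrow> 1) at_top" and bot: "(H \<longlongrightarrow> - 1) at_bot"
    using eigenpair kink by (simp_all add: eigenpair_def kink_def)
  show "(\<psi> \<longlongrightarrow> 0) at_top" "(deriv \<psi> \<longlongrightarrow> 0) at_top"
    using L2_solution_decays[OF DERIV_\<psi> DERIV_deriv_\<psi> L2 tendsto_potential[OF top] asymptotic_potential_pos]
    by simp_all
  show "(\<psi> \<longlongrightarrow> 0) at_bot" "(deriv \<psi> \<longlongrightarrow> 0) at_bot"
    using L2_solution_decays_at_bot[OF DERIV_\<psi> DERIV_deriv_\<psi> L2 tendsto_potential[OF bot] asymptotic_potential_pos]
    by simp_all
qed

lemma \<phi>_tendsto_0: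
  assumes "(\<psi> \<longlongrightarrow> 0) F" "(deriv \<psi> \<longlongrightarrow> 0) F" "(H \<longlongrightarrow> a) F"
  shows "(\<phi> \<longlongrightarrow> 0) F" "(\<phi>' \<longlongrightarrow> 0) F"
proof -
  have G: "(G \<longlongrightarrow> inv_sqrt2 * speed' \<epsilon> a) F"
    unfolding G_def[abs_def] speed'_def by (intro tendsto_intros assms(3))
  show \<phi>: "(\<phi> \<longlongrightarrow> 0) F"
    using tendsto_diff[OF tendsto_mult[OF G assms(1)] assms(2)] by (simp add: \<phi>_eq[abs_def])
  show "(\<phi>' \<longlongrightarrow> 0) F"
    using tendsto_diff[OF tendsto_mult_left[OF assms(1), of \<mu>] tendsto_mult[OF G \<phi>]]
    by (simp add: \<phi>'_def[abs_def])
qed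

text \<open>If \<open>\<phi>\<close> vanished, \<open>\<psi>\<close> would be a multiple of \<open>H'\<close> and hence belong to the eigenvalue \<open>0\<close>.\<close>

lemma \<phi>_nonzero: "\<exists>x. \<phi> x \<noteq> 0"
proof (rule ccontr)
  assume "\<nexists>x. \<phi> x \<noteq> 0"
  then have \<phi>0: "\<phi> = (\<lambda>x. 0)" by auto
  have "\<phi>' x = 0" for x
    using DERIV_unique[OF DERIV_\<phi>[of x]] unfolding \<phi>0 by simp
  moreover have "\<mu> \<noteq> 0"
    using near by auto
  ultimately have "\<psi> x = 0" for x
    by (simp add: \<phi>'_def \<phi>0)
  then show False
    using eigenpair by (simp add: eigenpair_def)
qed

section \<open>Comparison with the approximate ground state\<close>

definition \<nu> where "\<nu> = 3/2 + 12/5 * \<epsilon>"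

definition Q where "Q x = inv_sqrt2 * slope \<epsilon> (H x)"

text \<open>How far \<open>\<phi>\<close> is from satisfying the first-order equation \<open>\<phi>' = Q \<phi>\<close> of the approximate ground state.\<close>

definition h where "h x = \<phi>' x - Q x * \<phi> x"

text \<open>The derivative of \<open>h\<close>, with \<open>\<phi>''\<close> eliminated by the equation for \<open>\<phi>\<close> and \<open>Q'\<close> by the approximate
Riccati equation.\<close>

definition h' where "h' x = (\<nu> - \<mu> + \<epsilon>\<^sup>2 * resid \<epsilon> (H x)) * \<phi> x - Q x * h x"

lemma DERIV_Q: "(Q has_real_derivative speed \<epsilon> (H x) * slope' \<epsilon> (H x) / 2) (at x)"
proof -
  have "inv_sqrt2 * (slope' \<epsilon> (H x) * (inv_sqrt2 * speed \<epsilon> (H x))) = (inv_sqrt2 * inv_sqrt2) * (speed \<epsilon> (H x) * slope' \<epsilon> (H x))"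
    by simp
  also have "\<dots> = speed \<epsilon> (H x) * slope' \<epsilon> (H x) / 2"
    unfolding inv_sqrt2_square by simp
  finally show ?thesis
    unfolding Q_def[abs_def]
    using DERIV_cmult[OF DERIV_comp_H[OF DERIV_slope], of inv_sqrt2 \<epsilon> x] by (simp only:)
qed

lemma Q_square: "(Q x)\<^sup>2 = (slope \<epsilon> (H x))\<^sup>2 / 2"
  using inv_sqrt2_square by (simp add: Q_def power2_eq_square)

lemma U_eq:
  "U x = speed \<epsilon> (H x) * slope' \<epsilon> (H x) / 2 + (Q x)\<^sup>2 + \<nu> + \<epsilon>\<^sup>2 * resid \<epsilon> (H x)"
  using slope_riccati[of \<epsilon> "H x"] by (simp add: Q_square U_def \<nu>_def)

lemma abs_Q_le_1: "\<bar>Q x\<bar> \<le> 1"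
proof -
  have m: "\<bar>H x ^ 3\<bar> \<le> 1"
    using abs_H_le_1[of x] by (simp add: power_abs power_le_one)
  have "\<bar>11 * H x + H x ^ 3\<bar> \<le> 12"
    using m abs_H_le_1[of x] by linarith
  then have "\<epsilon> * \<bar>11 * H x + H x ^ 3\<bar> \<le> 1/400 * 12"
    using eps_nonneg eps_small by (intro mult_mono) auto
  then have "\<bar>\<epsilon> * (11 * H x + H x ^ 3)\<bar> \<le> 12/400"
    using eps_nonneg by (simp add: abs_mult)
  then have "\<bar>slope \<epsilon> (H x)\<bar> \<le> 4/3"
    unfolding slope_def using abs_H_le_1[of x] by linarith
  then have "inv_sqrt2 * \<bar>slope \<epsilon> (H x)\<bar> \<le> 3/4 * (4/3)"
    using inv_sqrt2_bounds inv_sqrt2_pos by (intro mult_mono) auto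
  then show ?thesis
    using inv_sqrt2_pos by (simp add: Q_def abs_mult)
qed

lemma DERIV_h: "(h has_real_derivative h' x) (at x)"
proof -
  have "(U x - \<mu>) * \<phi> x - (speed \<epsilon> (H x) * slope' \<epsilon> (H x) / 2 * \<phi> x + \<phi>' x * Q x) = h' x"
    unfolding h'_def h_def U_eq by (simp add: field_simps power2_eq_square)
  then show ?thesis
    unfolding h_def[abs_def]
    using DERIV_diff[OF DERIV_\<phi>' DERIV_mult[OF DERIV_Q DERIV_\<phi>], of x] by (simp only:)
qed

text \<open>The constant \<open>\<nu> - \<mu>\<close> in \<open>h'\<close> disappears from the source term: it multiplies \<open>\<phi>' - Q \<phi> = h\<close>.
Therefore \<open>h\<close> can be bounded by \<open>O(\<epsilon>\<^sup>2)\<close> before anything is known about \<open>\<nu> - \<mu>\<close>.\<close>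

lemma DERIV_h':
  "(h' has_real_derivative
      (U x - speed \<epsilon> (H x) * slope' \<epsilon> (H x) - \<mu>) * h x
      + \<epsilon>\<^sup>2 * (resid' \<epsilon> (H x) * (inv_sqrt2 * speed \<epsilon> (H x))) * \<phi> x) (at x)"
proof -
  have "((\<lambda>x. \<nu> - \<mu> + \<epsilon>\<^sup>2 * resid \<epsilon> (H x)) has_real_derivative
      \<epsilon>\<^sup>2 * (resid' \<epsilon> (H x) * (inv_sqrt2 * speed \<epsilon> (H x)))) (at x)"
    by (auto intro!: derivative_eq_intros DERIV_comp_H DERIV_resid)
  note d = DERIV_diff[OF DERIV_mult[OF this DERIV_\<phi>] DERIV_mult[OF DERIV_Q DERIV_h]]
  have "\<epsilon>\<^sup>2 * (resid' \<epsilon> (H x) * (inv_sqrt2 * speed \<epsilon> (H x))) * \<phi> x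
        + \<phi>' x * (\<nu> - \<mu> + \<epsilon>\<^sup>2 * resid \<epsilon> (H x))
        - (speed \<epsilon> (H x) * slope' \<epsilon> (H x) / 2 * h x + h' x * Q x)
      = (U x - speed \<epsilon> (H x) * slope' \<epsilon> (H x) - \<mu>) * h x
        + \<epsilon>\<^sup>2 * (resid' \<epsilon> (H x) * (inv_sqrt2 * speed \<epsilon> (H x))) * \<phi> x"
    unfolding h'_def h_def U_eq by (simp add: field_simps power2_eq_square)
  with d show ?thesis
    unfolding h'_def[abs_def] by (simp only:)
qed

lemma \<phi>_decays:
  shows "(\<phi> \<longlongrightarrow> 0) at_top" "(\<phi> \<longlongrightarrow> 0) at_bot" "(h \<longlongrightarrow> 0) at_top" "(h \<longlongrightarrow> 0) at_bot"
proof -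
  have top: "(H \<longlongrightarrow> 1) at_top" and bot: "(H \<longlongrightarrow> - 1) at_bot"
    using kink by (simp_all add: kink_def)
  note t = \<phi>_tendsto_0[OF \<psi>_decays(1,2) top] and b = \<phi>_tendsto_0[OF \<psi>_decays(3,4) bot]
  show "(\<phi> \<longlongrightarrow> 0) at_top" "(\<phi> \<longlongrightarrow> 0) at_bot" by (fact t(1), fact b(1))
  have "(h \<longlongrightarrow> 0) F" if "(\<phi> \<longlongrightarrow> 0) F" "(\<phi>' \<longlongrightarrow> 0) F" "(H \<longlongrightarrow> a) F" for F a
  proof -
    have "(Q \<longlongrightarrow> inv_sqrt2 * slope \<epsilon> a) F"
      unfolding Q_def[abs_def] slope_def by (intro tendsto_intros that(3)) auto
    from tendsto_diff[OF that(2) tendsto_mult[OF this that(1)]] show ?thesis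
      by (simp add: h_def[abs_def])
  qed
  then show "(h \<longlongrightarrow> 0) at_top" "(h \<longlongrightarrow> 0) at_bot"
    using t b top bot by blast+
qed

text \<open>Maximum principle for \<open>h\<close> and \<open>- h\<close>: the coefficient of \<open>h\<close> in its equation is at least \<open>1/4\<close>, and
the source term is at most \<open>100 \<epsilon>\<^sup>2 M\<close>.\<close>

lemma abs_h_le:
  assumes M: "\<And>x. \<bar>\<phi> x\<bar> \<le> M"
  shows "\<bar>h x\<bar> \<le> 400 * \<epsilon>\<^sup>2 * M"
proof -
  have M0: "M \<ge> 0" using M[of 0] by linarith
  define c where "c = (\<lambda>x. U x - speed \<epsilon> (H x) * slope' \<epsilon> (H x) - \<mu>)"
  define f where "f = (\<lambda>x. \<epsilon>\<^sup>2 * (resid' \<epsilon> (H x) * (inv_sqrt2 * speed \<epsilon> (H x))) * \<phi> x)"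
  have c: "c x \<ge> 1/4" for x
    using perturbed_gap[OF eps_nonneg _ abs_H_le_1[of x]] near eps_small
    unfolding c_def U_def by linarith
  have f: "\<bar>f x\<bar> \<le> 100 * \<epsilon>\<^sup>2 * M" for x
  proof -
    have "\<bar>resid' \<epsilon> (H x)\<bar> * \<bar>inv_sqrt2 * speed \<epsilon> (H x)\<bar> \<le> 100 * 1"
      using abs_resid_le(2)[of \<epsilon> "H x"] abs_H_le_1[of x] eps_nonneg eps_small H_deriv_bounds[of x]
      by (intro mult_mono) auto
    then have "\<epsilon>\<^sup>2 * (\<bar>resid' \<epsilon> (H x)\<bar> * \<bar>inv_sqrt2 * speed \<epsilon> (H x)\<bar>) * \<bar>\<phi> x\<bar> \<le> \<epsilon>\<^sup>2 * 100 * M"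
      using M[of x] by (intro mult_mono mult_left_mono) auto
    then show ?thesis by (simp add: f_def abs_mult mult_ac)
  qed
  have d': "(h' has_real_derivative c x * h x + f x) (at x)" for x
    using DERIV_h' unfolding c_def f_def .
  have key: "\<sigma> * (c x * h x + f x) > 0" if "\<sigma> * h x > 400 * \<epsilon>\<^sup>2 * M" "\<sigma> = 1 \<or> \<sigma> = - 1" for \<sigma> x
  proof -
    have "\<sigma> * h x > 0"
      using that(1) M0 by (smt (verit) mult_nonneg_nonneg zero_le_power2)
    then have "1/4 * (\<sigma> * h x) \<le> c x * (\<sigma> * h x)"
      using c[of x] by (intro mult_right_mono) auto
    moreover have "\<sigma> * f x \<ge> - (100 * \<epsilon>\<^sup>2 * M)"
      using f[of x] that(2) by auto
    ultimately show ?thesis using that(1) by (simp add: distrib_left mult.left_commute)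
  qed
  have B: "400 * \<epsilon>\<^sup>2 * M \<ge> 0" using M0 by simp
  have "\<sigma> * h x \<le> 400 * \<epsilon>\<^sup>2 * M" if \<sigma>: "\<sigma> = 1 \<or> \<sigma> = - 1" for \<sigma>
    by (rule max_principle[where f = "\<lambda>x. \<sigma> * h x", OF DERIV_cmult[OF DERIV_h] DERIV_cmult[OF d'] _ _ B])
       (use key \<sigma> tendsto_mult_left[OF \<phi>_decays(3), of \<sigma>] tendsto_mult_left[OF \<phi>_decays(4), of \<sigma>] in auto)
  from this[of 1] this[of "- 1"] show ?thesis by simp
qed

text \<open>At a maximum of \<open>|\<phi>|\<close> the derivative \<open>\<phi>' = Q \<phi> + h\<close> vanishes, so \<open>|Q| \<le> 400 \<epsilon>\<^sup>2\<close> there. As \<open>Q\<close> is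
close to \<open>- H / sqrt 2\<close>, the point is close to the zero of \<open>H\<close>.\<close>

lemma peak:
  obtains x0 where "\<bar>x0\<bar> < 1" "\<bar>\<phi> x0\<bar> > 0" "\<And>x. \<bar>\<phi> x\<bar> \<le> \<bar>\<phi> x0\<bar>"
proof -
  obtain a where a: "\<phi> a \<noteq> 0" using \<phi>_nonzero by blast
  have d: "((\<lambda>x. (\<phi> x)\<^sup>2) has_real_derivative 2 * \<phi> x * \<phi>' x) (at x)" for x
    by (auto intro!: derivative_eq_intros DERIV_\<phi>)
  have cont: "continuous_on UNIV (\<lambda>x. (\<phi> x)\<^sup>2)"
    using d by (meson DERIV_isCont continuous_at_imp_continuous_on)
  have lim: "((\<lambda>x. (\<phi> x)\<^sup>2) \<longlongrightarrow> 0) at_top" "((\<lambda>x. (\<phi> x)\<^sup>2) \<longlongrightarrow> 0) at_bot"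
    using tendsto_power[OF \<phi>_decays(1), of 2] tendsto_power[OF \<phi>_decays(2), of 2] by simp_all
  obtain x0 where x0: "\<And>x. (\<phi> x)\<^sup>2 \<le> (\<phi> x0)\<^sup>2"
    using attains_positive_max[OF cont lim, of a] a by auto
  then have max: "\<bar>\<phi> x\<bar> \<le> \<bar>\<phi> x0\<bar>" for x
    by (simp add: abs_le_square_iff)
  have pos: "\<bar>\<phi> x0\<bar> > 0" using max[of a] a by linarith
  have "2 * \<phi> x0 * \<phi>' x0 = 0"
    using DERIV_local_max[OF d[of x0], of 1] x0 by simp
  then have "\<phi>' x0 = 0" using pos by simp
  then have "\<bar>Q x0\<bar> * \<bar>\<phi> x0\<bar> \<le> 400 * \<epsilon>\<^sup>2 * \<bar>\<phi> x0\<bar>"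
    using abs_h_le[OF max, of x0] by (simp add: h_def abs_mult)
  then have "\<bar>Q x0\<bar> \<le> 400 * \<epsilon>\<^sup>2" using pos by simp
  also have "\<dots> \<le> 400 * (1/400)\<^sup>2"
    using eps_nonneg eps_small by (intro mult_left_mono power_mono) auto
  finally have "inv_sqrt2 * \<bar>slope \<epsilon> (H x0)\<bar> \<le> 1/400"
    using inv_sqrt2_pos by (simp add: Q_def abs_mult power2_eq_square)
  \<comment> \<open>The factor \<open>1/2\<close> leaves room for the cubic correction; \<open>7/10\<close> bounds \<open>1 / sqrt 2\<close> from below.\<close>
  moreover have "7/10 * (1/2 * \<bar>H x0\<bar>) \<le> inv_sqrt2 * \<bar>slope \<epsilon> (H x0)\<bar>"
  proof (rule mult_mono)
    have "(H x0)\<^sup>2 \<le> 1" using abs_H_le_1[of x0] by (simp add: abs_square_le_1)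
    then have "\<epsilon> * (11 + (H x0)\<^sup>2) \<le> 1/400 * 12"
      using eps_nonneg eps_small by (intro mult_mono) auto
    then have "1/2 \<le> \<bar>1 - \<epsilon> * (11 + (H x0)\<^sup>2) / 5\<bar>" by linarith
    then have "1/2 * \<bar>H x0\<bar> \<le> \<bar>1 - \<epsilon> * (11 + (H x0)\<^sup>2) / 5\<bar> * \<bar>H x0\<bar>"
      by (intro mult_right_mono) auto
    also have "\<dots> = \<bar>- (1 - \<epsilon> * (11 + (H x0)\<^sup>2) / 5) * H x0\<bar>"
      by (simp only: abs_mult abs_minus_cancel)
    also have "- (1 - \<epsilon> * (11 + (H x0)\<^sup>2) / 5) * H x0 = slope \<epsilon> (H x0)"
      by (simp add: slope_def field_simps power2_eq_square power3_eq_cube)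
    finally show "1/2 * \<bar>H x0\<bar> \<le> \<bar>slope \<epsilon> (H x0)\<bar>" .
  qed (use inv_sqrt2_bounds in auto)
  ultimately have "\<bar>H x0\<bar> < 1/4" by linarith
  then have "\<bar>x0\<bar> < 1" by (rule abs_less_1_if_abs_H_small)
  with that pos max show thesis by blast
qed

lemma abs_Q_plus_tanh_le: "\<bar>Q y + inv_sqrt2 * tanh (inv_sqrt2 * y)\<bar> \<le> \<epsilon> * (\<bar>y\<bar> + 3)"
proof -
  have m: "\<bar>H y ^ 3\<bar> \<le> 1"
    using abs_H_le_1[of y] by (simp add: power_abs power_le_one)
  then have "\<bar>(11 * H y + H y ^ 3) / 5\<bar> \<le> 3"
    using abs_H_le_1[of y] by (simp add: abs_le_iff)
  then have "\<bar>\<epsilon> * (11 * H y + H y ^ 3) / 5\<bar> \<le> \<epsilon> * 3"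
    using eps_nonneg mult_left_mono[of "\<bar>(11 * H y + H y ^ 3) / 5\<bar>" 3 \<epsilon>] by (simp add: abs_mult)
  then have le: "\<bar>slope \<epsilon> (H y) + tanh (inv_sqrt2 * y)\<bar> \<le> \<epsilon> * (\<bar>y\<bar> + 3)"
    using dist_kink_tanh[of y] unfolding slope_def distrib_left[of \<epsilon> "\<bar>y\<bar>"] by linarith
  have "\<bar>Q y + inv_sqrt2 * tanh (inv_sqrt2 * y)\<bar> = inv_sqrt2 * \<bar>slope \<epsilon> (H y) + tanh (inv_sqrt2 * y)\<bar>"
    using inv_sqrt2_pos by (simp add: Q_def abs_mult distrib_left[symmetric])
  also have "\<dots> \<le> 1 * (\<epsilon> * (\<bar>y\<bar> + 3))"
    using inv_sqrt2_bounds le by (intro mult_mono) auto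
  finally show ?thesis by simp
qed

text \<open>The quotient \<open>g\<close> of \<open>\<phi>\<close> by the unperturbed ground state \<open>sech (x / sqrt 2)\<close> has derivative \<open>O(\<epsilon>)\<close> on
compact sets, so it stays near its value at the peak. The derivative of \<open>g\<close> is
estimated with \<open>|\<phi>| \<le> M\<close> alone, so zeros of \<open>\<phi>\<close> on the compact set are excluded by the conclusion.\<close>

lemma \<phi>_lower_bound:
  assumes X: "X \<ge> 1" and small: "4 * \<epsilon> * X * (X + 4) * cosh X \<le> 1"
  obtains M where "M > 0" "\<And>x. \<bar>\<phi> x\<bar> \<le> M" "\<And>x. \<bar>x\<bar> \<le> X \<Longrightarrow> M \<le> 2 * cosh X * \<bar>\<phi> x\<bar>"
proof -
  obtain x0 where x0: "\<bar>x0\<bar> < 1" "\<bar>\<phi> x0\<bar> > 0" and max: "\<And>x. \<bar>\<phi> x\<bar> \<le> \<bar>\<phi> x0\<bar>"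
    using peak by blast
  define M where "M = \<bar>\<phi> x0\<bar>"
  define g where "g = (\<lambda>y. \<phi> y * cosh (inv_sqrt2 * y))"
  define g' where "g' = (\<lambda>y. cosh (inv_sqrt2 * y) * ((Q y + inv_sqrt2 * tanh (inv_sqrt2 * y)) * \<phi> y + h y))"
  have dg: "(g has_real_derivative g' y) (at y)" for y
    unfolding g_def g'_def
    by (auto intro!: derivative_eq_intros DERIV_\<phi> simp: h_def tanh_def algebra_simps)
  have cosh_le: "cosh (inv_sqrt2 * y) \<le> cosh X" if "\<bar>y\<bar> \<le> X" for y
  proof -
    have "\<bar>inv_sqrt2 * y\<bar> \<le> 1 * X"
      unfolding abs_mult using inv_sqrt2_bounds inv_sqrt2_pos that by (intro mult_mono) auto
    then have "cosh \<bar>inv_sqrt2 * y\<bar> \<le> cosh X"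
      using X by (subst cosh_real_nonneg_le_iff) auto
    then show ?thesis by simp
  qed
  have g'_le: "\<bar>g' y\<bar> \<le> cosh X * (\<epsilon> * (X + 4) * M)" if y: "\<bar>y\<bar> \<le> X" for y
  proof -
    have "\<bar>Q y + inv_sqrt2 * tanh (inv_sqrt2 * y)\<bar> \<le> \<epsilon> * (X + 3)"
      using abs_Q_plus_tanh_le[of y] y eps_nonneg mult_left_mono[of "\<bar>y\<bar> + 3" "X + 3" \<epsilon>] by linarith
    then have "\<bar>Q y + inv_sqrt2 * tanh (inv_sqrt2 * y)\<bar> * \<bar>\<phi> y\<bar> \<le> \<epsilon> * (X + 3) * M"
      using max[of y] X eps_nonneg by (intro mult_mono) (auto simp: M_def)
    moreover have "400 * \<epsilon>\<^sup>2 * M \<le> \<epsilon> * M"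
      using eps_nonneg eps_small mult_left_mono[of "400 * \<epsilon>" 1 \<epsilon>]
      by (intro mult_right_mono) (auto simp: power2_eq_square M_def)
    then have "\<bar>h y\<bar> \<le> \<epsilon> * M"
      using abs_h_le[OF max, of y] by (simp add: M_def)
    moreover have "\<epsilon> * (X + 4) * M = \<epsilon> * (X + 3) * M + \<epsilon> * M"
      by (simp add: algebra_simps)
    ultimately have "\<bar>(Q y + inv_sqrt2 * tanh (inv_sqrt2 * y)) * \<phi> y + h y\<bar> \<le> \<epsilon> * (X + 4) * M"
      by (simp add: abs_mult[symmetric])
    then show ?thesis
      unfolding g'_def abs_mult using cosh_le[OF y] by (intro mult_mono) auto
  qed
  have lower: "M \<le> 2 * cosh X * \<bar>\<phi> x\<bar>" if x: "\<bar>x\<bar> \<le> X" for x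
  proof -
    have "norm (g x - g x0) \<le> cosh X * (\<epsilon> * (X + 4) * M) * norm (x - x0)"
    proof (rule field_differentiable_bound[of "{-X..X}" g g'])
      show "norm (g' z) \<le> cosh X * (\<epsilon> * (X + 4) * M)" if "z \<in> {-X..X}" for z
        using g'_le[of z] that by (simp add: abs_le_iff[of z])
    qed (use has_field_derivative_at_within[OF dg] x x0(1) X in auto)
    then have "\<bar>g x - g x0\<bar> \<le> cosh X * (\<epsilon> * (X + 4) * M) * \<bar>x - x0\<bar>"
      by simp
    also have "\<dots> \<le> cosh X * (\<epsilon> * (X + 4) * M) * (2 * X)"
      using x x0 X eps_nonneg by (intro mult_left_mono) (auto simp: M_def)
    also have "\<dots> = (4 * \<epsilon> * X * (X + 4) * cosh X) * M / 2"
      by simp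
    also have "\<dots> \<le> M / 2"
      using mult_right_mono[OF small, of M] x0(2) unfolding M_def
      by (intro divide_right_mono) simp_all
    finally have "\<bar>g x - g x0\<bar> \<le> M / 2" .
    moreover have "M * 1 \<le> \<bar>g x0\<bar>"
      unfolding g_def abs_mult M_def using cosh_real_ge_1[of "inv_sqrt2 * x0"] by (intro mult_left_mono) auto
    moreover have "\<bar>g x\<bar> \<le> \<bar>\<phi> x\<bar> * cosh X"
      unfolding g_def abs_mult using cosh_le[OF x] by (intro mult_left_mono) auto
    ultimately have "M \<le> 2 * (\<bar>\<phi> x\<bar> * cosh X)" by linarith
    then show ?thesis by (simp add: mult_ac)
  qed
  show thesis
    using that[of M] x0 max lower by (simp add: M_def)
qed

lemma V\<^sub>2_eq: "V\<^sub>2 \<epsilon> H x = U x"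
  using speed_H_pos[of x]
  unfolding V\<^sub>2_def deriv_deriv_W unfolding deriv_W W_speed U_def second_potential_def
  by (simp add: field_simps power2_eq_square)

text \<open>The derivative of \<open>\<phi>' / \<phi>\<close> is eliminated by the Riccati equation.\<close>

lemma V\<^sub>3_eq:
  assumes "\<phi> x \<noteq> 0"
  shows "V\<^sub>3 \<epsilon> H \<psi> x = 2 * (\<phi>' x / \<phi> x)\<^sup>2 + 2 * \<mu> - U x"
proof -
  have d: "deriv \<phi> = \<phi>'" using DERIV_\<phi> DERIV_imp_deriv by blast
  have "deriv (\<lambda>y. \<phi>' y / \<phi> y) x
      = ((U x - \<mu>) * \<phi> x * \<phi> x - \<phi>' x * \<phi>' x) / (\<phi> x * \<phi> x)"
    by (intro DERIV_imp_deriv DERIV_divide DERIV_\<phi> DERIV_\<phi>' assms)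
  also have "\<dots> = U x - \<mu> - (\<phi>' x / \<phi> x)\<^sup>2"
    using assms by (simp add: field_simps power2_eq_square)
  finally show ?thesis
    unfolding V\<^sub>3_def \<phi>_def[symmetric] Let_def d V\<^sub>2_eq by simp
qed

text \<open>On \<open>[- X, X]\<close> the maximum of \<open>|\<phi>|\<close> is at most \<open>\<kappa> |\<phi>|\<close>. This converts the bound on \<open>h\<close> into bounds on
\<open>\<phi>' / \<phi> - Q = h / \<phi>\<close> and on \<open>\<nu> - \<mu>\<close>, and these into the expansion of \<open>V\<^sub>3\<close>.\<close>

lemma V\<^sub>3_expansion:
  assumes X: "X \<ge> 1" and small: "4 * \<epsilon> * X * (X + 4) * cosh X \<le> 1" and x: "\<bar>x\<bar> \<le> X"
    and \<kappa>: "\<kappa> = 2 * cosh X"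
  shows "\<bar>V\<^sub>3 \<epsilon> H \<psi> x - (2 + \<epsilon> * first_variation (tanh (inv_sqrt2 * x)))\<bar>
      \<le> (34 + 8 * X + 4060 * \<kappa> + 320000 * \<kappa>\<^sup>2) * \<epsilon>\<^sup>2"
proof -
  obtain M where M: "M > 0" and max: "\<And>x. \<bar>\<phi> x\<bar> \<le> M"
    and lower: "\<And>x. \<bar>x\<bar> \<le> X \<Longrightarrow> M \<le> \<kappa> * \<bar>\<phi> x\<bar>"
    using \<phi>_lower_bound[OF X small] unfolding \<kappa> by blast
  have \<kappa>1: "\<kappa> \<ge> 1" using cosh_real_ge_1[of X] by (simp add: \<kappa>)
  have nz: "\<bar>\<phi> y\<bar> > 0" if "\<bar>y\<bar> \<le> X" for y
    using lower[OF that] M \<kappa>1 by (cases "\<phi> y = 0") auto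
  have eig: "\<bar>\<nu> - \<mu>\<bar> \<le> 1230 * \<kappa> * \<epsilon>\<^sup>2"
  proof -
    \<comment> \<open>The equation for \<open>h'\<close> at a mean value point: all terms but \<open>(\<nu> - \<mu>) \<phi>\<close> are already \<open>O(\<epsilon>\<^sup>2)\<close>.\<close>
    obtain z where z: "0 < z" "z < 1" "h 1 - h 0 = (1 - 0) * h' z"
      using MVT2[of 0 1 h h'] DERIV_h by auto
    have zX: "\<bar>z\<bar> \<le> X" using z X by auto
    have "\<bar>Q z\<bar> * \<bar>h z\<bar> \<le> 1 * (400 * \<epsilon>\<^sup>2 * M)"
      using abs_Q_le_1[of z] abs_h_le[OF max, of z] by (intro mult_mono) auto
    moreover have "\<bar>\<epsilon>\<^sup>2 * resid \<epsilon> (H z)\<bar> * \<bar>\<phi> z\<bar> \<le> \<epsilon>\<^sup>2 * 30 * M"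
      unfolding abs_mult using abs_resid_le(1)[of \<epsilon> "H z"] abs_H_le_1[of z] eps_nonneg eps_small max[of z]
      by (intro mult_mono) auto
    moreover have "(\<nu> - \<mu>) * \<phi> z = h 1 - h 0 + Q z * h z - \<epsilon>\<^sup>2 * resid \<epsilon> (H z) * \<phi> z"
      using z(3) by (simp add: h'_def algebra_simps)
    ultimately have "\<bar>(\<nu> - \<mu>) * \<phi> z\<bar> \<le> 1230 * \<epsilon>\<^sup>2 * M"
      using abs_h_le[OF max, of 0] abs_h_le[OF max, of 1] by (simp add: abs_mult[symmetric])
    also have "\<dots> \<le> 1230 * \<epsilon>\<^sup>2 * (\<kappa> * \<bar>\<phi> z\<bar>)"
      using lower[OF zX] by (intro mult_left_mono) auto
    finally have "\<bar>\<nu> - \<mu>\<bar> * \<bar>\<phi> z\<bar> \<le> 1230 * \<kappa> * \<epsilon>\<^sup>2 * \<bar>\<phi> z\<bar>"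
      by (simp add: abs_mult mult_ac)
    then show ?thesis using nz[OF zX] by simp
  qed
  define d where "d = h x / \<phi> x"
  have d: "\<bar>d\<bar> \<le> 400 * \<kappa> * \<epsilon>\<^sup>2"
  proof -
    have "\<bar>h x\<bar> \<le> 400 * \<epsilon>\<^sup>2 * (\<kappa> * \<bar>\<phi> x\<bar>)"
      using abs_h_le[OF max, of x] mult_left_mono[OF lower[OF x], of "400 * \<epsilon>\<^sup>2"] by simp
    then show ?thesis
      using nz[OF x] by (simp add: d_def divide_le_eq mult_ac)
  qed
  have Qd: "\<bar>Q x * d\<bar> \<le> 400 * \<kappa> * \<epsilon>\<^sup>2"
    using mult_mono[OF abs_Q_le_1[of x] d] by (simp add: abs_mult)
  have dd: "d\<^sup>2 \<le> 160000 * \<kappa>\<^sup>2 * \<epsilon>\<^sup>2"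
  proof -
    have "\<epsilon>\<^sup>2 * \<epsilon>\<^sup>2 \<le> 1 * \<epsilon>\<^sup>2"
      using eps_nonneg eps_small by (intro mult_right_mono) (auto simp: power_le_one)
    then have "160000 * \<kappa>\<^sup>2 * (\<epsilon>\<^sup>2 * \<epsilon>\<^sup>2) \<le> 160000 * \<kappa>\<^sup>2 * \<epsilon>\<^sup>2"
      by (intro mult_left_mono) auto
    moreover have "d\<^sup>2 \<le> (400 * \<kappa> * \<epsilon>\<^sup>2)\<^sup>2"
      using power_mono[OF d, of 2] by simp
    ultimately show ?thesis by (simp add: power_mult_distrib power2_eq_square mult_ac)
  qed
  have "\<phi> x \<noteq> 0" using nz[OF x] by auto
  then have q: "\<phi>' x / \<phi> x = Q x + d"
    by (simp add: d_def h_def field_simps)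
  have V3: "V\<^sub>3 \<epsilon> H \<psi> x = (slope \<epsilon> (H x))\<^sup>2 + 2 * \<nu> - second_potential \<epsilon> (H x) - 2 * (\<nu> - \<mu>) + 4 * (Q x * d) + 2 * d\<^sup>2"
    unfolding V\<^sub>3_eq[OF \<open>\<phi> x \<noteq> 0\<close>] q U_def using Q_square[of x] by (simp add: power2_eq_square algebra_simps)
  have poly: "\<bar>(slope \<epsilon> (H x))\<^sup>2 + 2 * \<nu> - second_potential \<epsilon> (H x) - (2 + \<epsilon> * first_variation (H x))\<bar> \<le> 34 * \<epsilon>\<^sup>2"
    unfolding \<nu>_def using approximate_V\<^sub>3_expansion[OF eps_nonneg _ abs_H_le_1[of x]] eps_small by simp
  have fv: "\<bar>\<epsilon> * first_variation (H x) - \<epsilon> * first_variation (tanh (inv_sqrt2 * x))\<bar> \<le> 8 * X * \<epsilon>\<^sup>2"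
  proof -
    have "\<bar>tanh (inv_sqrt2 * x)\<bar> \<le> 1"
      using tanh_real_lt_1[of "inv_sqrt2 * x"] tanh_real_gt_neg1[of "inv_sqrt2 * x"] by (simp add: abs_le_iff)
    then have "\<bar>first_variation (H x) - first_variation (tanh (inv_sqrt2 * x))\<bar> \<le> 8 * \<bar>H x - tanh (inv_sqrt2 * x)\<bar>"
      by (rule first_variation_lipschitz[OF abs_H_le_1])
    also have "\<dots> \<le> 8 * (\<epsilon> * X)"
      using dist_kink_tanh[of x] mult_left_mono[OF x eps_nonneg] by simp
    finally have "\<epsilon> * \<bar>first_variation (H x) - first_variation (tanh (inv_sqrt2 * x))\<bar> \<le> \<epsilon> * (8 * (\<epsilon> * X))"
      by (rule mult_left_mono[OF _ eps_nonneg])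
    then show ?thesis
      using eps_nonneg by (simp add: right_diff_distrib[symmetric] abs_mult power2_eq_square mult_ac)
  qed
  have combine: "\<bar>v - (2 + g)\<bar> \<le> a\<^sub>1 + a\<^sub>2 + 2 * a\<^sub>3 + 4 * a\<^sub>4 + 2 * a\<^sub>5"
    if "v = p - 2 * m + 4 * t + 2 * r" "\<bar>p - (2 + f)\<bar> \<le> a\<^sub>1" "\<bar>f - g\<bar> \<le> a\<^sub>2" "\<bar>m\<bar> \<le> a\<^sub>3"
      "\<bar>t\<bar> \<le> a\<^sub>4" "0 \<le> r" "r \<le> a\<^sub>5" for v p m t r f g a\<^sub>1 a\<^sub>2 a\<^sub>3 a\<^sub>4 a\<^sub>5 :: real
    using that by linarith
  have "(34 + 8 * X + 4060 * \<kappa> + 320000 * \<kappa>\<^sup>2) * \<epsilon>\<^sup>2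
      = 34 * \<epsilon>\<^sup>2 + 8 * X * \<epsilon>\<^sup>2 + 2 * (1230 * \<kappa> * \<epsilon>\<^sup>2) + 4 * (400 * \<kappa> * \<epsilon>\<^sup>2) + 2 * (160000 * \<kappa>\<^sup>2 * \<epsilon>\<^sup>2)"
    by (simp add: algebra_simps)
  with combine[OF V3 poly fv eig Qd zero_le_power2 dd] show ?thesis by simp
qed

end

section \<open>Expansion of the twice transformed potential\<close>

theorem proposition10p1:
  "\<exists>\<delta>>0. \<forall>\<epsilon>\<^sub>0 (H :: real \<Rightarrow> real \<Rightarrow> real) (\<Lambda> :: real \<Rightarrow> real) (\<psi> :: real \<Rightarrow> real \<Rightarrow> real).
     0 < \<epsilon>\<^sub>0 \<and> \<epsilon>\<^sub>0 \<le> 1 \<and>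
     (\<forall>\<epsilon>\<in>{0..<\<epsilon>\<^sub>0}. kink \<epsilon> (H \<epsilon>) \<and> eigenpair (V\<^sub>1 \<epsilon> (H \<epsilon>)) (\<Lambda> \<epsilon>) (\<psi> \<epsilon>) \<and>
        \<bar>\<Lambda> \<epsilon> - 3/2\<bar> < \<delta>) \<longrightarrow>
     (\<exists>Vt :: real \<Rightarrow> real.
        (\<forall>x. ((\<lambda>\<epsilon>. V\<^sub>3 \<epsilon> (H \<epsilon>) (\<psi> \<epsilon>) x) has_real_derivative Vt x) (at 0 within {0..})) \<and>
        (\<forall>x. (\<lambda>\<epsilon>. V\<^sub>3 \<epsilon> (H \<epsilon>) (\<psi> \<epsilon>) x - (2 + \<epsilon> * Vt x)) \<in> O[at_right 0](\<lambda>\<epsilon>. \<epsilon>\<^sup>2)) \<and>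
        (\<forall>x. Vt x = 6/5 * (sech (x / sqrt 2))\<^sup>2 + 3/5 * (sech (x / sqrt 2)) ^ 4) \<and>
        (\<forall>x. x \<noteq> 0 \<longrightarrow> x * deriv Vt x < 0))"
proof (intro exI[of _ "1/8"] conjI allI impI, goal_cases)
  case 1
  show ?case by simp
next
  case (2 \<epsilon>\<^sub>0 H \<Lambda> \<psi>)
  then have e0: "0 < \<epsilon>\<^sub>0"
    and fam: "\<And>\<epsilon>. 0 \<le> \<epsilon> \<Longrightarrow> \<epsilon> < \<epsilon>\<^sub>0 \<Longrightarrow>
      kink \<epsilon> (H \<epsilon>) \<and> eigenpair (V\<^sub>1 \<epsilon> (H \<epsilon>)) (\<Lambda> \<epsilon>) (\<psi> \<epsilon>) \<and> \<bar>\<Lambda> \<epsilon> - 3/2\<bar> < 1/8"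
    by auto
  define Vt where "Vt = (\<lambda>x. first_variation (tanh (inv_sqrt2 * x)))"
  have "((\<lambda>\<epsilon>. V\<^sub>3 \<epsilon> (H \<epsilon>) (\<psi> \<epsilon>) x) has_real_derivative Vt x) (at 0 within {0..}) \<and>
      (\<lambda>\<epsilon>. V\<^sub>3 \<epsilon> (H \<epsilon>) (\<psi> \<epsilon>) x - (2 + \<epsilon> * Vt x)) \<in> O[at_right 0](\<lambda>\<epsilon>. \<epsilon>\<^sup>2)" for x
  proof -
    define X where "X = 1 + \<bar>x\<bar>"
    define K where "K = 4 * X * (X + 4) * cosh X"
    define C where "C = 34 + 8 * X + 4060 * (2 * cosh X) + 320000 * (2 * cosh X)\<^sup>2"
    have X: "X \<ge> 1" "\<bar>x\<bar> \<le> X" by (simp_all add: X_def)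
    have K: "K > 0" unfolding K_def using X cosh_real_pos[of X] by (intro mult_pos_pos) auto
    \<comment> \<open>The threshold \<open>1 / K\<close> makes the variation of \<open>\<phi> x * cosh (x / sqrt 2)\<close> over \<open>[- X, X]\<close> at most half of the peak of \<open>|\<phi>|\<close>.\<close>
    define e where "e = min \<epsilon>\<^sub>0 (min (1/400) (1 / K))"
    have e: "e > 0" using e0 K by (simp add: e_def)
    have "\<bar>V\<^sub>3 \<epsilon> (H \<epsilon>) (\<psi> \<epsilon>) x - (2 + \<epsilon> * Vt x)\<bar> \<le> C * \<epsilon>\<^sup>2" if \<epsilon>: "0 \<le> \<epsilon>" "\<epsilon> < e" for \<epsilon>
    proof -
      have "\<epsilon> < \<epsilon>\<^sub>0" "\<epsilon> \<le> 1/400" "\<epsilon> \<le> 1 / K" using \<epsilon> by (auto simp: e_def)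
      interpret perturbed_eigenpair \<epsilon> "H \<epsilon>" "\<Lambda> \<epsilon>" "\<psi> \<epsilon>"
        using fam[OF \<epsilon>(1) \<open>\<epsilon> < \<epsilon>\<^sub>0\<close>] \<epsilon>(1) \<open>\<epsilon> \<le> 1/400\<close> by unfold_locales auto
      have "4 * \<epsilon> * X * (X + 4) * cosh X \<le> 1"
        using \<open>\<epsilon> \<le> 1 / K\<close> K by (simp add: le_divide_eq K_def mult_ac)
      from V\<^sub>3_expansion[OF X(1) this X(2) refl] show ?thesis
        by (simp add: C_def Vt_def)
    qed
    from quadratic_remainder[OF e this] show ?thesis by blast
  qed
  moreover have "Vt x = 6/5 * (sech (x / sqrt 2))\<^sup>2 + 3/5 * (sech (x / sqrt 2)) ^ 4" for x
    by (simp add: Vt_def first_variation_tanh inv_sqrt2_def)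
  moreover have "x * deriv Vt x < 0" if "x \<noteq> 0" for x
    using first_variation_decreases_away_from_0[OF that] by (simp add: Vt_def)
  ultimately show ?case by blast
qed

end
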